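(* Let $(\Omega_1,\mu_1)$ and $(\Omega_2,\mu_2)$ be measure spaces, let $0<q<p_1,p_2\le\infty$, let $0<\theta<1$, and let $f\colon\Omega_1\times\Omega_2\to\mathbb{R}$ be measurable. Put $\alpha_j=\frac1q-\frac1{p_j}$ for $j=1,2$. Then $$f\in\big(L_{p_1,\infty}(\mu_1;L_q(\mu_2)),\,L_{p_2,\infty}(\mu_2;L_q(\mu_1))\big)_{\theta,\infty}$$ if and only if $$\sup_{E_1\subset\Omega_1,\,E_2\subset\Omega_2}\left(\int_{E_1\times E_2}|f|^q\,d\mu_1d\mu_2\right)^{\frac1q}\left(\mu_1(E_1)^{(1-\theta)\alpha_1}\mu_2(E_2)^{\theta\alpha_2}\right)^{-1}<\infty,$$ and the corresponding (quasi-)norms are equivalent. When $q=1$, this condition means that the operator with kernel $|f|$, namely $$T_{|f|}\colon g\mapsto\int|f(x,y)|\,g(y)\,d\mu_2(y),$$ is bounded from $L_{r,1}(\mu_2)$ to $L_{s,\infty}(\mu_1)$, where $\frac1r=\theta\alpha_2=\frac{\theta}{p_2'}$ and $\frac1{s'}=1-\frac1s=\frac{1-\theta}{p_1'}$.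
   Context: Conventions: $1/\infty=0$, and $p'$ is the conjugate exponent, $\frac1p+\frac1{p'}=1$. The supremum is over measurable subsets $E_j\subset\Omega_j$, and the quotient is considered for sets with $0<\mu_j(E_j)<\infty$. For a measure space $(\Omega,\mu)$ and $0<p<\infty$, $L_{p,\infty}(\mu)$ is the space of measurable $h$ with $\|h\|_{p,\infty}=\sup_{c>0}\big(c^p\mu\{|h|>c\}\big)^{1/p}<\infty$; for $p=\infty$, $L_{\infty,\infty}=L_\infty$. For $1<r<\infty$, the Lorentz space $L_{r,1}(\mu)$ is the space of measurable $h$ with $\int_0^\infty\mu\{|h|>c\}^{1/r}\,dc<\infty$. $L_{p_1,\infty}(\mu_1;L_q(\mu_2))$ is the space of measurable functions $g$ on $\Omega_1\times\Omega_2$ such that $\omega_1\mapsto\|g(\omega_1,\cdot)\|_{L_q(\mu_2)}$ belongs to $L_{p_1,\infty}(\mu_1)$, with (quasi-)norm the $L_{p_1,\infty}(\mu_1)$ quasi-norm of that function. $L_{p_2,\infty}(\mu_2;L_q(\mu_1))$ is defined in the same way with the roles of the two variables exchanged. For a compatible couple $(A_0,A_1)$ of (quasi-)Banach spaces, $K_t(x;A_0,A_1)=\inf\{\|x_0\|_{A_0}+t\|x_1\|_{A_1} : x=x_0+x_1,\ x_0\in A_0,\ x_1\in A_1\}$, and $(A_0,A_1)_{\theta,\infty}$ is the space of all $x\in A_0+A_1$ with $\|x\|_{\theta,\infty}=\sup_{t>0}t^{-\theta}K_t(x;A_0,A_1)<\infty$.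
   Formalization: Both measure spaces are assumed sigma-finite, so that the product measure is well defined; without this the claim fails, e.g. for one-point spaces with mu_1 infinite, mu_2 = 1, p_1 finite and f = 1, where the supremum is over no sets although f is not in the sum of the two spaces. *)

theory Defs
  imports "HOL-Probability.Essential_Supremum"
begin

text \<open>Powers of extended nonnegative numbers; only used with exponent \<open>a > 0\<close>, where
  \<open>\<infinity> powr a = \<infinity>\<close>.\<close>

definition epowr :: "ennreal \<Rightarrow> real \<Rightarrow> ennreal" where
  "epowr x a = (if x = top then top else ennreal (enn2real x powr a))"

text \<open>\<open>1/p\<close> as a real number for \<open>0 < p \<le> \<infinity>\<close>, with \<open>1/\<infinity> = 0\<close>.\<close>

definition recip :: "ennreal \<Rightarrow> real" where
  "recip p = enn2real (1 / p)"

definition conj_exponent :: "ennreal \<Rightarrow> ennreal" where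
  "conj_exponent p = 1 / (1 - 1 / p)"

lemma conj_exponent_sum:
  assumes "1 \<le> p"
  shows "1 / p + 1 / conj_exponent p = 1"
proof -
  have inv: "1 / (1 / x) = x" for x :: ennreal
    by (cases x; cases "x = 0") (auto simp: divide_ennreal_def inverse_ennreal)
  have "1 / p \<le> 1"
    using assms by (intro divide_le_posI_ennreal) (auto intro: less_le_trans[OF zero_less_one])
  then show ?thesis
    unfolding conj_exponent_def inv by simp
qed

lemma recip_top: "recip top = 0"
  by (simp add: recip_def divide_ennreal_def)

lemma recip_ennreal: "0 < p \<Longrightarrow> recip (ennreal p) = 1 / p"
  by (simp add: recip_def divide_ennreal_def inverse_ennreal inverse_eq_divide)

text \<open>Weak \<open>L\<^sub>p\<close> is set up for functions with values in \<open>[0,\<infinity>]\<close>, so that it applies to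
  \<open>\<lambda>x. \<parallel>g(x,\<cdot>)\<parallel>\<close> even when that function takes the value \<open>\<infinity>\<close> (a finite quasi-norm forces it to be
  finite almost everywhere). A real function \<open>h\<close> is in weak \<open>L\<^sub>p\<close> iff \<open>\<lambda>x. ennreal \<bar>h x\<bar>\<close> is
  and \<open>h\<close> is measurable.\<close>

definition weak_Lp_norm :: "ennreal \<Rightarrow> 'a measure \<Rightarrow> ('a \<Rightarrow> ennreal) \<Rightarrow> ennreal" where
  "weak_Lp_norm p M h =
     (if p = top then esssup M h
      else (SUP c\<in>{0<..}. epowr (ennreal (c powr enn2real p) * emeasure M {x \<in> space M. ennreal c < h x})
                                (1 / enn2real p)))"

definition weak_Lp :: "ennreal \<Rightarrow> 'a measure \<Rightarrow> ('a \<Rightarrow> ennreal) set" where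
  "weak_Lp p M = {h \<in> borel_measurable M. weak_Lp_norm p M h < top}"

definition Lorentz1_norm :: "real \<Rightarrow> 'a measure \<Rightarrow> ('a \<Rightarrow> real) \<Rightarrow> ennreal" where
  "Lorentz1_norm r M h = (\<integral>\<^sup>+c\<in>{0<..}. epowr (emeasure M {x \<in> space M. c < \<bar>h x\<bar>}) (1 / r) \<partial>lborel)"

definition Lorentz1 :: "real \<Rightarrow> 'a measure \<Rightarrow> ('a \<Rightarrow> real) set" where
  "Lorentz1 r M = {h \<in> borel_measurable M. Lorentz1_norm r M h < top}"

definition Lq_norm :: "real \<Rightarrow> 'a measure \<Rightarrow> ('a \<Rightarrow> real) \<Rightarrow> ennreal" where
  "Lq_norm q M h = epowr (\<integral>\<^sup>+x. ennreal (\<bar>h x\<bar> powr q) \<partial>M) (1 / q)"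

definition mixed_norm1 ::
    "ennreal \<Rightarrow> real \<Rightarrow> 'a measure \<Rightarrow> 'b measure \<Rightarrow> ('a \<times> 'b \<Rightarrow> real) \<Rightarrow> ennreal" where
  "mixed_norm1 p q M1 M2 g = weak_Lp_norm p M1 (\<lambda>x. Lq_norm q M2 (\<lambda>y. g (x, y)))"

definition mixed_space1 ::
    "ennreal \<Rightarrow> real \<Rightarrow> 'a measure \<Rightarrow> 'b measure \<Rightarrow> ('a \<times> 'b \<Rightarrow> real) set" where
  "mixed_space1 p q M1 M2 =
     {g \<in> borel_measurable (M1 \<Otimes>\<^sub>M M2). (\<lambda>x. Lq_norm q M2 (\<lambda>y. g (x, y))) \<in> weak_Lp p M1}"

definition mixed_norm2 ::
    "ennreal \<Rightarrow> real \<Rightarrow> 'a measure \<Rightarrow> 'b measure \<Rightarrow> ('a \<times> 'b \<Rightarrow> real) \<Rightarrow> ennreal" where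
  "mixed_norm2 p q M1 M2 g = weak_Lp_norm p M2 (\<lambda>y. Lq_norm q M1 (\<lambda>x. g (x, y)))"

definition mixed_space2 ::
    "ennreal \<Rightarrow> real \<Rightarrow> 'a measure \<Rightarrow> 'b measure \<Rightarrow> ('a \<times> 'b \<Rightarrow> real) set" where
  "mixed_space2 p q M1 M2 =
     {g \<in> borel_measurable (M1 \<Otimes>\<^sub>M M2). (\<lambda>y. Lq_norm q M1 (\<lambda>x. g (x, y))) \<in> weak_Lp p M2}"

text \<open>A couple is given by two sets \<open>A0\<close>, \<open>A1\<close> of measurable functions on \<open>M\<close> with their
  (quasi-)norms \<open>n0\<close>, \<open>n1\<close>. Functions represent their classes modulo equality almost everywhere,
  hence the AE in the decompositions \<open>x = x0 + x1\<close>. The infimum over the empty set is \<open>\<infinity>\<close>.\<close>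

definition decompositions ::
    "'c measure \<Rightarrow> ('c \<Rightarrow> real) set \<Rightarrow> ('c \<Rightarrow> real) set \<Rightarrow> ('c \<Rightarrow> real) \<Rightarrow> (('c \<Rightarrow> real) \<times> ('c \<Rightarrow> real)) set" where
  "decompositions M A0 A1 x = {(x0, x1). x0 \<in> A0 \<and> x1 \<in> A1 \<and> (AE z in M. x z = x0 z + x1 z)}"

definition K_functional ::
    "'c measure \<Rightarrow> ('c \<Rightarrow> real) set \<Rightarrow> (('c \<Rightarrow> real) \<Rightarrow> ennreal) \<Rightarrow> ('c \<Rightarrow> real) set \<Rightarrow> (('c \<Rightarrow> real) \<Rightarrow> ennreal)
      \<Rightarrow> real \<Rightarrow> ('c \<Rightarrow> real) \<Rightarrow> ennreal" where
  "K_functional M A0 n0 A1 n1 t x =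
     (INF (x0, x1)\<in>decompositions M A0 A1 x. n0 x0 + ennreal t * n1 x1)"

definition interp_norm ::
    "'c measure \<Rightarrow> ('c \<Rightarrow> real) set \<Rightarrow> (('c \<Rightarrow> real) \<Rightarrow> ennreal) \<Rightarrow> ('c \<Rightarrow> real) set \<Rightarrow> (('c \<Rightarrow> real) \<Rightarrow> ennreal)
      \<Rightarrow> real \<Rightarrow> ('c \<Rightarrow> real) \<Rightarrow> ennreal" where
  "interp_norm M A0 n0 A1 n1 \<theta> x =
     (SUP t\<in>{0<..}. ennreal (t powr (- \<theta>)) * K_functional M A0 n0 A1 n1 t x)"

definition interp_space ::
    "'c measure \<Rightarrow> ('c \<Rightarrow> real) set \<Rightarrow> (('c \<Rightarrow> real) \<Rightarrow> ennreal) \<Rightarrow> ('c \<Rightarrow> real) set \<Rightarrow> (('c \<Rightarrow> real) \<Rightarrow> ennreal)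
      \<Rightarrow> real \<Rightarrow> ('c \<Rightarrow> real) set" where
  "interp_space M A0 n0 A1 n1 \<theta> =
     {x \<in> borel_measurable M. decompositions M A0 A1 x \<noteq> {} \<and> interp_norm M A0 n0 A1 n1 \<theta> x < top}"

definition mixed_interp_norm ::
    "real \<Rightarrow> ennreal \<Rightarrow> ennreal \<Rightarrow> real \<Rightarrow> 'a measure \<Rightarrow> 'b measure \<Rightarrow> ('a \<times> 'b \<Rightarrow> real) \<Rightarrow> ennreal" where
  "mixed_interp_norm q p1 p2 \<theta> M1 M2 =
     interp_norm (M1 \<Otimes>\<^sub>M M2) (mixed_space1 p1 q M1 M2) (mixed_norm1 p1 q M1 M2)
                            (mixed_space2 p2 q M1 M2) (mixed_norm2 p2 q M1 M2) \<theta>"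

definition mixed_interp_space ::
    "real \<Rightarrow> ennreal \<Rightarrow> ennreal \<Rightarrow> real \<Rightarrow> 'a measure \<Rightarrow> 'b measure \<Rightarrow> ('a \<times> 'b \<Rightarrow> real) set" where
  "mixed_interp_space q p1 p2 \<theta> M1 M2 =
     interp_space (M1 \<Otimes>\<^sub>M M2) (mixed_space1 p1 q M1 M2) (mixed_norm1 p1 q M1 M2)
                             (mixed_space2 p2 q M1 M2) (mixed_norm2 p2 q M1 M2) \<theta>"

definition rect_sup ::
    "real \<Rightarrow> real \<Rightarrow> real \<Rightarrow> 'a measure \<Rightarrow> 'b measure \<Rightarrow> ('a \<times> 'b \<Rightarrow> real) \<Rightarrow> ennreal" where
  "rect_sup q a b M1 M2 f =
     (SUP (E1, E2) \<in> {E1 \<in> sets M1. 0 < emeasure M1 E1 \<and> emeasure M1 E1 < top}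
                   \<times> {E2 \<in> sets M2. 0 < emeasure M2 E2 \<and> emeasure M2 E2 < top}.
        epowr (\<integral>\<^sup>+z\<in>E1 \<times> E2. ennreal (\<bar>f z\<bar> powr q) \<partial>(M1 \<Otimes>\<^sub>M M2)) (1 / q)
        / ennreal (measure M1 E1 powr a * measure M2 E2 powr b))"

definition kernel_op :: "'b measure \<Rightarrow> ('a \<times> 'b \<Rightarrow> real) \<Rightarrow> ('b \<Rightarrow> real) \<Rightarrow> 'a \<Rightarrow> real" where
  "kernel_op M2 k g x = (LINT y|M2. k (x, y) * g y)"

text \<open>Boundedness includes that the defining integral converges absolutely for almost every \<open>x\<close>;
  otherwise the Bochner integral would silently be \<open>0\<close>.\<close>

definition kernel_op_bounded ::
    "real \<Rightarrow> real \<Rightarrow> 'a measure \<Rightarrow> 'b measure \<Rightarrow> ('a \<times> 'b \<Rightarrow> real) \<Rightarrow> bool" where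
  "kernel_op_bounded r s M1 M2 k \<longleftrightarrow>
     (\<exists>C::real. 0 \<le> C \<and> (\<forall>g \<in> Lorentz1 r M2.
        (AE x in M1. integrable M2 (\<lambda>y. k (x, y) * g y)) \<and>
        kernel_op M2 k g \<in> borel_measurable M1 \<and>
        (\<lambda>x. ennreal \<bar>kernel_op M2 k g x\<bar>) \<in> weak_Lp (ennreal s) M1 \<and>
        weak_Lp_norm (ennreal s) M1 (\<lambda>x. ennreal \<bar>kernel_op M2 k g x\<bar>)
          \<le> ennreal C * Lorentz1_norm r M2 g))"

end

theory Submission
  imports Defs
begin

text \<open>
  Put \<open>g = \<bar>f\<bar>\<^sup>q\<close> and \<open>a\<^sub>j = q \<alpha>\<^sub>j = 1 - q / p\<^sub>j\<close>. The whole argument is about integrals of \<open>g\<close> over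
  rectangles, because weak \<open>L\<^sub>p\<close> is a condition on integrals: for \<open>q < p\<close> and \<open>h \<ge> 0\<close>, the quasi-norm of
  \<open>h\<close> to the power \<open>1/q\<close> in weak \<open>L\<^sub>p\<close> is comparable to the best \<open>N\<close> such that
  \<open>\<integral>\<^sub>E h \<le> N\<^sup>q \<mu>(E) powr (1 - q/p)\<close> for all \<open>E\<close> of finite measure
  (\<open>weak_Lp_norm_imp_integral_bound\<close>, \<open>integral_bound_imp_weak_Lp_norm\<close>). In this form the condition
  is stable under convex combinations and under monotone and almost everywhere limits.

  If \<open>f = f\<^sub>1 + f\<^sub>2\<close>, integrating \<open>\<bar>f\<^sub>1\<bar>\<^sup>q\<close> and \<open>\<bar>f\<^sub>2\<bar>\<^sup>q\<close> over \<open>E\<^sub>1 \<times> E\<^sub>2\<close> bounds the integral of \<open>g\<close> by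
  \<open>\<mu>\<^sub>1(E\<^sub>1) powr a\<^sub>1\<close> and \<open>\<mu>\<^sub>2(E\<^sub>2) powr a\<^sub>2\<close> times powers of the two quasi-norms; choosing \<open>t\<close> so that the two terms
  balance gives the rectangle condition (\<open>rect_sup_le_interp_norm\<close>).

  For the converse a decomposition has to be built for every \<open>t\<close>, and it is enough to cut the product
  space into two pieces \<open>W\<close> and its complement, \<open>f\<^sub>1\<close> being the restriction of \<open>f\<close> to \<open>W\<close>. On a
  rectangle \<open>A \<times> B\<close> of finite measure, alternate between rows and columns. From the current rows
  \<open>R\<close> and columns \<open>F\<close>, keep the set \<open>R'\<close> of rows on which
  \<open>\<integral>\<^bsub>X \<times> F\<^esub> g - c \<mu>\<^sub>1(X) powr a\<^sub>1\<close> is largest, and let the discarded rows \<open>R - R'\<close> contribute \<open>(R - R') \<times> F\<close> to \<open>W\<close>;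
  then do the same with columns. Maximality says that the discarded
  mass over a set \<open>E\<close> is at most the drop of \<open>c \<mu>\<^sub>1(E \<inter> R) powr a\<^sub>1\<close>
  (\<open>excess_maximiser\<close>), so that the bounds of all steps telescope instead of adding up. The excess over \<open>R'\<close>
  is nonnegative, so the rectangle condition forces the measures of the kept sets to decay geometrically,
  and nothing is left in the limit (\<open>block_decomposition\<close>).

  The cuts obtained on larger and larger rectangles need not converge. Relaxing sets to functions
  with values in \<open>[0,1]\<close> makes the admissible cuts a decreasing sequence of convex sets that are closed under almost
  everywhere limits, and such a sequence has a common element, by the parallelogram law
  (\<open>decseq_midpoint_convex_Inter_nonempty\<close>); its level set at \<open>1/2\<close> is the required \<open>W\<close>
  (\<open>product_decomposition\<close>).

  For \<open>q = 1\<close> the rectangle condition is the boundedness of \<open>T\<^bsub>\<bar>f\<bar>\<^esub>\<close> on indicator functions. It extends to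
  \<open>L\<^bsub>r,1\<^esub>\<close> since every \<open>\<bar>g\<bar>\<close> is the integral over \<open>c\<close> of the indicators of \<open>{\<bar>g\<bar> > c}\<close>, and the
  \<open>L\<^bsub>r,1\<^esub>\<close> norm is the integral of their norms.
\<close>

section \<open>Maximal excess of a measure over a power of a measure\<close>

text \<open>By concavity the increment of \<open>t powr a\<close> over a step of length \<open>y - m\<close> is larger at \<open>t = m\<close> than at
  \<open>t = x\<close>. With \<open>x\<close>, \<open>y\<close>, \<open>m\<close> the measures of two sets and of their intersection, this is the submodularity of
  \<open>\<mu>(X) powr a\<close>.\<close>
lemma powr_submodular:
  fixes a m x y :: real
  assumes a: "0 < a" "a \<le> 1" and m: "0 \<le> m" "m \<le> x" "m \<le> y"
  shows "(x + y - m) powr a + m powr a \<le> x powr a + y powr a"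
proof -
  define d where "d = y - m"
  have d: "0 \<le> d" using m by (simp add: d_def)
  have "(x + d) powr a - x powr a \<le> (m + d) powr a - m powr a"
  proof (rule DERIV_nonpos_imp_decreasing_open[OF \<open>m \<le> x\<close>])
    fix t assume t: "m < t" "t < x"
    then have "0 < t" using m by simp
    have "((\<lambda>t. (t + d) powr a - t powr a) has_real_derivative
        (a * (t + d) powr (a - 1) - a * t powr (a - 1))) (at t)"
      using \<open>0 < t\<close> d by (auto intro!: derivative_eq_intros)
    moreover have "(t + d) powr (a - 1) \<le> t powr (a - 1)"
      using \<open>0 < t\<close> d a by (intro powr_mono2') auto
    ultimately show "\<exists>z. ((\<lambda>t. (t + d) powr a - t powr a) has_real_derivative z) (at t) \<and> z \<le> 0"
      using a by (intro exI[of _ "a * (t + d) powr (a - 1) - a * t powr (a - 1)"]) (simp add: mult_left_mono)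
  next
    show "continuous_on {m..x} (\<lambda>t. (t + d) powr a - t powr a)"
      using a m d by (intro continuous_intros continuous_on_powr') auto
  qed
  then show ?thesis by (simp add: d_def algebra_simps)
qed

text \<open>The functional \<open>J(X) = N(X) - c M(X) powr a\<close> is supermodular, so that finite unions of near maximisers
  are near maximisers, and the limes superior of a sequence of them is a maximiser \<open>R'\<close>. Comparing \<open>R'\<close>
  with \<open>{}\<close> gives the lower bound for \<open>N(R')\<close>. Comparing \<open>E\<close> with \<open>E \<inter> R'\<close> through supermodularity gives the
  upper bound off \<open>R'\<close>, in a form whose right-hand side telescopes when the lemma is applied repeatedly.\<close>
lemma excess_maximiser:
  fixes M N :: "'a measure" and a c :: real
  assumes sets_N: "sets N = sets M" and R: "R \<in> sets M" 
    and fin: "emeasure M R < top" "emeasure N R < top" and a: "0 < a" "a \<le> 1" and c: "0 \<le> c"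
  obtains R' where "R' \<in> sets M" "R' \<subseteq> R" "c * measure M R' powr a \<le> measure N R'"
    "\<And>E. E \<in> sets M \<Longrightarrow> E \<subseteq> R \<Longrightarrow>
       measure N (E - R') \<le> c * (measure M E powr a - measure M (E \<inter> R') powr a)"
proof -
  define J where "J X = measure N X - c * measure M X powr a" for X
  define A where "A = {X \<in> sets M. X \<subseteq> R}"
  have fmM: "X \<in> fmeasurable M" if "X \<in> A" for X
    using that fin emeasure_mono[of X R M] R by (auto simp: A_def fmeasurable_def)
  have fmN: "X \<in> fmeasurable N" if "X \<in> A" for X
    using that fin emeasure_mono[of X R N] R sets_N by (auto simp: A_def fmeasurable_def)
  have A_ops: "X \<union> Y \<in> A" "X \<inter> Y \<in> A" "X - Y \<in> A" if "X \<in> A" "Y \<in> A" for X Y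
    using that by (auto simp: A_def)
  have super: "J X + J Y \<le> J (X \<union> Y) + J (X \<inter> Y)" if "X \<in> A" "Y \<in> A" for X Y
  proof -
    let ?m = "measure M (X \<inter> Y)" and ?x = "measure M X" and ?y = "measure M Y"
    have "?m \<le> ?x" "?m \<le> ?y"
      using fmM that A_ops by (auto intro!: measure_mono_fmeasurable simp: fmeasurable_def)
    then have "(?x + ?y - ?m) powr a + ?m powr a \<le> ?x powr a + ?y powr a"
      using a by (intro powr_submodular) auto
    then have "measure M (X \<union> Y) powr a + ?m powr a \<le> ?x powr a + ?y powr a"
      using that fmM by (simp add: measure_Un3)
    then have "c * (measure M (X \<union> Y) powr a + ?m powr a) \<le> c * (?x powr a + ?y powr a)"
      using c by (rule mult_left_mono)
    moreover have "measure N (X \<union> Y) + measure N (X \<inter> Y) = measure N X + measure N Y"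
      using that fmN by (simp add: measure_Un3)
    ultimately show ?thesis by (simp add: J_def algebra_simps)
  qed
  define s where "s = Sup (J ` A)"
  have bdd: "bdd_above (J ` A)"
  proof (rule bdd_aboveI2)
    fix X assume "X \<in> A"
    then have "measure N X \<le> measure N R"
      using fmN[of R] fmN[of X] R by (intro measure_mono_fmeasurable) (auto simp: A_def fmeasurable_def)
    then show "J X \<le> measure N R" using c by (simp add: J_def add_increasing2 algebra_simps)
  qed
  have le_s: "J X \<le> s" if "X \<in> A" for X
    unfolding s_def using bdd that by (rule cSUP_upper2) auto
  have "\<exists>X\<in>A. s - (1/2)^n < J X" for n :: nat
  proof -
    have "A \<noteq> {}" by (auto simp: A_def)
    then show ?thesis using bdd less_cSUP_iff[of A J "s - (1/2)^n"] by (auto simp: s_def)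
  qed
  then obtain X where X: "X n \<in> A" "s - (1/2)^n < J (X n)" for n :: nat by metis
  have J_lim: "(\<lambda>k. J (Y k)) \<longlonglongrightarrow> J Z"
    if "(\<lambda>k. measure N (Y k)) \<longlonglongrightarrow> measure N Z" "(\<lambda>k. measure M (Y k)) \<longlonglongrightarrow> measure M Z" for Y Z
    unfolding J_def using that a by (auto intro!: tendsto_intros)
  \<comment> \<open>The errors \<open>2 powr -m\<close> of the sets \<open>X m\<close>, \<open>m \<ge> n\<close>, add up to at most \<open>2 * 2 powr -n\<close> for their union.\<close>
  define V where "V n = (\<Union>m\<in>{n..}. X m)" for n
  have V_A: "V n \<in> A" for n using X(1) by (auto simp: V_def A_def)
  have V_J: "s - 2 * (1/2)^n \<le> J (V n)" for n
  proof -
    define U where "U k = (\<Union>m\<in>{n..n+k}. X m)" for k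
    have U_A: "U k \<in> A" for k using X(1) by (auto simp: U_def A_def)
    have "s - 2 * (1/2)^n + (1/2)^(n+k) \<le> J (U k)" for k
    proof (induction k)
      case 0
      then show ?case using X(2)[of n] by (simp add: U_def)
    next
      case (Suc k)
      have "U (Suc k) = U k \<union> X (n + Suc k)" by (auto simp: U_def atLeastAtMostSuc_conv)
      moreover have "J (U k \<inter> X (n + Suc k)) \<le> s" using U_A X(1) by (intro le_s A_ops)
      ultimately show ?case
        using super[OF U_A[of k] X(1)[of "n + Suc k"]] X(2)[of "n + Suc k"] Suc by simp
    qed
    then have *: "s - 2 * (1/2)^n \<le> J (U k)" for k
      by (rule order_trans[rotated]) simp
    have UV: "(\<Union>k. U k) = V n"
    proof (intro antisym subsetI)
      fix x assume "x \<in> V n"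
      then obtain m where "m \<ge> n" "x \<in> X m" by (auto simp: V_def)
      then have "x \<in> U (m - n)" by (auto simp: U_def)
      then show "x \<in> (\<Union>k. U k)" by blast
    qed (auto simp: V_def U_def)
    have inc: "incseq U" unfolding U_def by (intro incseq_SucI UN_mono) auto
    have "(\<lambda>k. measure M (U k)) \<longlonglongrightarrow> measure M (V n)" "(\<lambda>k. measure N (U k)) \<longlonglongrightarrow> measure N (V n)"
      using U_A fmM[OF V_A[of n]] fmN[OF V_A[of n]]  inc unfolding UV[symmetric]
      by (auto intro!: Lim_measure_incseq simp: A_def fmeasurable_def sets_N)
    then show ?thesis using * by (intro LIMSEQ_le_const[OF J_lim]) auto
  qed
  define R' where "R' = (\<Inter>n. V n)"
  have R'_A: "R' \<in> A" using V_A by (auto simp: R'_def A_def)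
  have V_fin: "emeasure M (V k) \<noteq> \<infinity>" "emeasure N (V k) \<noteq> \<infinity>" for k
    using fmM[OF V_A[of k]] fmN[OF V_A[of k]] by (auto simp: fmeasurable_def)
  have "decseq V" unfolding V_def by (intro decseq_SucI UN_mono) auto
  then have "(\<lambda>k. measure M (V k)) \<longlonglongrightarrow> measure M R'" "(\<lambda>k. measure N (V k)) \<longlonglongrightarrow> measure N R'"
    unfolding R'_def using V_A V_fin by (auto intro!: Lim_measure_decseq simp: A_def sets_N)
  then have "(\<lambda>k. J (V k)) \<longlonglongrightarrow> J R'" by (intro J_lim)
  moreover have "(\<lambda>n::nat. s - 2 * (1/2)^n) \<longlonglongrightarrow> s - 2 * 0"
    by (intro tendsto_intros LIMSEQ_power_zero) auto
  ultimately have max: "s \<le> J R'" using V_J LIMSEQ_le by fastforce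
  show thesis
  proof (rule that[of R'])
    show "R' \<in> sets M" "R' \<subseteq> R" using R'_A by (auto simp: A_def)
    have "J {} \<le> s" by (rule le_s) (simp add: A_def)
    then show "c * measure M R' powr a \<le> measure N R'" using max by (simp add: J_def)
    fix E assume "E \<in> sets M" "E \<subseteq> R"
    then have E: "E \<in> A" by (simp add: A_def)
    have "J E \<le> J (E \<inter> R')"
      using super[OF E R'_A] le_s[OF A_ops(1)[OF E R'_A]] max by simp
    moreover have disj: "E \<inter> R' \<inter> (E - R') = {}" by blast
    have "measure N E = measure N (E \<inter> R') + measure N (E - R')"
      using measure_Un3[OF fmN[OF A_ops(2)[OF E R'_A]] fmN[OF A_ops(3)[OF E R'_A]]]
      by (simp add: Un_Diff_Int Int_Diff_Un disj)
    ultimately show "measure N (E - R') \<le> c * (measure M E powr a - measure M (E \<inter> R') powr a)"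
      by (simp add: J_def algebra_simps)
  qed
qed

section \<open>Cutting a rectangle of finite measure\<close>

text \<open>The maximal excess for the marginal measure \<open>E \<mapsto> \<nu>(E \<times> F)\<close>.\<close>
lemma row_cut:
  fixes \<nu> :: "('a \<times> 'b) measure"
  assumes sets_\<nu>: "sets \<nu> = sets (M1 \<Otimes>\<^sub>M M2)" and R: "R \<in> sets M1" and F: "F \<in> sets M2"
    and fin: "emeasure M1 R < top" "emeasure \<nu> (R \<times> F) < top" and a: "0 < a" "a \<le> 1" and c: "0 \<le> c"
  obtains R' where "R' \<in> sets M1" "R' \<subseteq> R" "c * measure M1 R' powr a \<le> measure \<nu> (R' \<times> F)"
    "\<And>E. E \<in> sets M1 \<Longrightarrow> E \<subseteq> R \<Longrightarrow>
       measure \<nu> ((E - R') \<times> F) \<le> c * (measure M1 E powr a - measure M1 (E \<inter> R') powr a)"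
proof -
  define N where "N = distr (density \<nu> (indicator (space M1 \<times> F))) M1 fst"
  have sp: "space \<nu> = space M1 \<times> space M2"
    using sets_eq_imp_space_eq[OF sets_\<nu>] by (simp add: space_pair_measure)
  have fst_m: "fst \<in> measurable \<nu> M1"
    using measurable_fst measurable_cong_sets[OF sets_\<nu> refl] by blast
  have N: "emeasure N E = emeasure \<nu> (E \<times> F)" if E: "E \<in> sets M1" for E
  proof -
    have 1: "space M1 \<times> F \<in> sets \<nu>" using F sets_\<nu> by auto
    have 2: "fst -` E \<inter> space \<nu> \<in> sets \<nu>" using fst_m E by (rule measurable_sets)
    have "emeasure N E = emeasure (density \<nu> (indicator (space M1 \<times> F))) (fst -` E \<inter> space \<nu>)"
      unfolding N_def using fst_m E by (subst emeasure_distr) auto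
    also have "\<dots> = emeasure \<nu> ((space M1 \<times> F) \<inter> (fst -` E \<inter> space \<nu>))"
      using 1 2 by (subst emeasure_density) (simp_all flip: indicator_inter_arith)
    also have "(space M1 \<times> F) \<inter> (fst -` E \<inter> space \<nu>) = E \<times> F"
      using sets.sets_into_space[OF E] sets.sets_into_space[OF F] sp by auto
    finally show ?thesis .
  qed
  obtain R' where R': "R' \<in> sets M1" "R' \<subseteq> R" "c * measure M1 R' powr a \<le> measure N R'"
    "\<And>E. E \<in> sets M1 \<Longrightarrow> E \<subseteq> R \<Longrightarrow>
       measure N (E - R') \<le> c * (measure M1 E powr a - measure M1 (E \<inter> R') powr a)"
    using excess_maximiser[of N M1 R a c] R fin a c N[OF R] by (auto simp: N_def)
  show thesis
    using that[of R'] R' by (simp add: N measure_def)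
qed

lemma column_cut:
  fixes \<nu> :: "('a \<times> 'b) measure"
  assumes sets_\<nu>: "sets \<nu> = sets (M1 \<Otimes>\<^sub>M M2)" and R: "R \<in> sets M1" and F: "F \<in> sets M2"
    and fin: "emeasure M2 F < top" "emeasure \<nu> (R \<times> F) < top" and a: "0 < a" "a \<le> 1" and c: "0 \<le> c"
  obtains F' where "F' \<in> sets M2" "F' \<subseteq> F" "c * measure M2 F' powr a \<le> measure \<nu> (R \<times> F')"
    "\<And>H. H \<in> sets M2 \<Longrightarrow> H \<subseteq> F \<Longrightarrow>
       measure \<nu> (R \<times> (H - F')) \<le> c * (measure M2 H powr a - measure M2 (H \<inter> F') powr a)"
proof -
  define \<nu>' where "\<nu>' = distr \<nu> (M2 \<Otimes>\<^sub>M M1) (\<lambda>(x, y). (y, x))"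
  have m: "(\<lambda>(x, y). (y, x)) \<in> measurable \<nu> (M2 \<Otimes>\<^sub>M M1)"
    using measurable_pair_swap' measurable_cong_sets[OF sets_\<nu> refl] by blast
  have sp: "space \<nu> = space M1 \<times> space M2"
    using sets_eq_imp_space_eq[OF sets_\<nu>] by (simp add: space_pair_measure)
  have eq: "emeasure \<nu>' (H \<times> E) = emeasure \<nu> (E \<times> H)" if "E \<in> sets M1" "H \<in> sets M2" for E H
  proof -
    have "emeasure \<nu>' (H \<times> E) = emeasure \<nu> ((\<lambda>(x, y). (y, x)) -` (H \<times> E) \<inter> space \<nu>)"
      unfolding \<nu>'_def using m that by (intro emeasure_distr) auto
    also have "(\<lambda>(x, y). (y, x)) -` (H \<times> E) \<inter> space \<nu> = E \<times> H"
      using that[THEN sets.sets_into_space] sp by auto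
    finally show ?thesis .
  qed
  obtain F' where F': "F' \<in> sets M2" "F' \<subseteq> F" "c * measure M2 F' powr a \<le> measure \<nu>' (F' \<times> R)"
    "\<And>H. H \<in> sets M2 \<Longrightarrow> H \<subseteq> F \<Longrightarrow>
       measure \<nu>' ((H - F') \<times> R) \<le> c * (measure M2 H powr a - measure M2 (H \<inter> F') powr a)"
    using row_cut[of \<nu>' M2 M1 F R a c] assms eq[OF R F] by (auto simp: \<nu>'_def)
  show thesis
    using that[of F'] F' R by (simp add: eq measure_def)
qed

text \<open>With \<open>x = \<mu>\<^sub>1(R') powr a\<^sub>1\<close> and \<open>y = \<mu>\<^sub>2(F) powr a\<^sub>2\<close>, the hypothesis combines the lower bound for the
  mass of \<open>R' \<times> F\<close> coming from the excess with the upper bound coming from the rectangle condition. The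
  factor 2 survives because \<open>2 powr \<theta> \<le> 2\<close>; it is what makes the alternating cuts contract. For columns the roles are swapped, with \<open>1 - \<theta>\<close> and \<open>1 / \<tau>\<close>.\<close>
lemma excess_set_small:
  fixes x y \<Lambda> \<tau> \<theta> :: real
  assumes "0 < \<theta>" "\<theta> < 1" "0 < \<Lambda>" "0 < \<tau>" "0 \<le> x" "0 \<le> y"
    and le: "2 * \<Lambda> * \<tau> powr \<theta> * x \<le> \<Lambda> * x powr (1 - \<theta>) * y powr \<theta>"
  shows "2 * \<tau> * x \<le> y"
proof (cases "x = 0")
  case False
  then have x: "0 < x" using assms by simp
  have "\<Lambda> * (2 * \<tau> powr \<theta> * x) \<le> \<Lambda> * (x powr (1 - \<theta>) * y powr \<theta>)"
    using le by (simp add: mult_ac)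
  then have "2 * \<tau> powr \<theta> * x \<le> x powr (1 - \<theta>) * y powr \<theta>"
    using \<open>0 < \<Lambda>\<close> by simp
  moreover have "x = x powr (1 - \<theta>) * x powr \<theta>"
    using x by (simp flip: powr_add)
  ultimately have "x powr (1 - \<theta>) * (2 * \<tau> powr \<theta> * x powr \<theta>) \<le> x powr (1 - \<theta>) * y powr \<theta>"
    by (metis mult.assoc mult.commute)
  then have *: "2 * \<tau> powr \<theta> * x powr \<theta> \<le> y powr \<theta>" using x by simp
  have "(2 * \<tau> * x) powr \<theta> = 2 powr \<theta> * (\<tau> powr \<theta> * x powr \<theta>)"
    using x assms by (simp add: powr_mult mult_ac)
  also have "\<dots> \<le> 2 * (\<tau> powr \<theta> * x powr \<theta>)"
    using powr_mono[of \<theta> 1 2] assms by (intro mult_right_mono) auto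
  finally have "(2 * \<tau> * x) powr \<theta> \<le> y powr \<theta>" using * by simp
  then show ?thesis
    using assms powr_less_mono2[of \<theta> y "2 * \<tau> * x"] by (meson not_le)
qed (use assms in simp)

text \<open>Alternate row cuts and column cuts, starting from \<open>R 0 = A\<close> and \<open>F 0 = B\<close>. The rows discarded at step
  \<open>k\<close> take with them all columns of \<open>F k\<close>, and this defines \<open>S\<close>. A point outside \<open>S\<close> whose row is discarded at some
  step has a column that was discarded earlier, so that its mass is controlled by a column cut; rows that are
  never discarded form a null set, because \<open>\<mu>\<^sub>2(F k) powr a2\<close> shrinks by a factor 4 at each step.\<close>
lemma block_decomposition:
  fixes \<nu> :: "('a \<times> 'b) measure"
  assumes sets_\<nu>: "sets \<nu> = sets (M1 \<Otimes>\<^sub>M M2)"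
    and A: "A \<in> sets M1" "emeasure M1 A < top" and B: "B \<in> sets M2" "emeasure M2 B < top"
    and \<theta>: "0 < \<theta>" "\<theta> < 1" and a1: "0 < a1" "a1 \<le> 1" and a2: "0 < a2" "a2 \<le> 1"
    and \<Lambda>: "0 < \<Lambda>" and \<tau>: "0 < \<tau>"
    and bound: "\<And>E F. E \<in> sets M1 \<Longrightarrow> F \<in> sets M2 \<Longrightarrow> E \<subseteq> A \<Longrightarrow> F \<subseteq> B \<Longrightarrow>
      emeasure \<nu> (E \<times> F) \<le>
        ennreal (\<Lambda> * measure M1 E powr ((1 - \<theta>) * a1) * measure M2 F powr (\<theta> * a2))"
  obtains S where "S \<in> sets (M1 \<Otimes>\<^sub>M M2)"
    "\<And>E. E \<in> sets M1 \<Longrightarrow> E \<subseteq> A \<Longrightarrow>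
       emeasure \<nu> ((E \<times> B) \<inter> S) \<le> ennreal (2 * \<Lambda> * \<tau> powr \<theta> * measure M1 E powr a1)"
    "\<And>F. F \<in> sets M2 \<Longrightarrow> F \<subseteq> B \<Longrightarrow>
       emeasure \<nu> ((A \<times> F) - S) \<le> ennreal (2 * \<Lambda> * \<tau> powr (\<theta> - 1) * measure M2 F powr a2)"
proof -
  define c1 where "c1 = 2 * \<Lambda> * \<tau> powr \<theta>"
  define c2 where "c2 = 2 * \<Lambda> * \<tau> powr (\<theta> - 1)"
  have c: "0 \<le> c1" "0 \<le> c2" using \<Lambda> by (auto simp: c1_def c2_def)
  have fin: "emeasure \<nu> (E \<times> F) < top" if "E \<in> sets M1" "F \<in> sets M2" "E \<subseteq> A" "F \<subseteq> B" for E F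
    using bound[OF that] by (rule order_le_less_trans) simp
  have bound': "measure \<nu> (E \<times> F) \<le>
      \<Lambda> * (measure M1 E powr a1) powr (1 - \<theta>) * (measure M2 F powr a2) powr \<theta>"
    if "E \<in> sets M1" "F \<in> sets M2" "E \<subseteq> A" "F \<subseteq> B" for E F
    using bound[OF that] fin[OF that] \<Lambda> by (simp add: emeasure_eq_ennreal_measure powr_powr mult_ac)
  define P :: "'a set \<times> 'b set \<Rightarrow> bool" where
    "P = (\<lambda>(R, F). R \<in> sets M1 \<and> R \<subseteq> A \<and> F \<in> sets M2 \<and> F \<subseteq> B)"
  define Q :: "'a set \<times> 'b set \<Rightarrow> 'a set \<times> 'b set \<Rightarrow> bool" where
    "Q = (\<lambda>(R, F) (R', F'). R' \<subseteq> R \<and> F' \<subseteq> F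
       \<and> c1 * measure M1 R' powr a1 \<le> measure \<nu> (R' \<times> F)
       \<and> (\<forall>E\<in>sets M1. E \<subseteq> R \<longrightarrow>
            measure \<nu> ((E - R') \<times> F) \<le> c1 * (measure M1 E powr a1 - measure M1 (E \<inter> R') powr a1))
       \<and> c2 * measure M2 F' powr a2 \<le> measure \<nu> (R' \<times> F')
       \<and> (\<forall>H\<in>sets M2. H \<subseteq> F \<longrightarrow>
            measure \<nu> (R' \<times> (H - F')) \<le> c2 * (measure M2 H powr a2 - measure M2 (H \<inter> F') powr a2)))"
  have step: "\<exists>RF'. P RF' \<and> Q RF RF'" if "P RF" for RF
  proof -
    obtain R F where RF: "RF = (R, F)" by (cases RF)
    have R: "R \<in> sets M1" "R \<subseteq> A" and F: "F \<in> sets M2" "F \<subseteq> B" using that by (auto simp: P_def RF)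
    have "emeasure M1 R < top" "emeasure M2 F < top"
      using A B R F emeasure_mono[of R A M1] emeasure_mono[of F B M2] by auto
    obtain R' where R': "R' \<in> sets M1" "R' \<subseteq> R" "c1 * measure M1 R' powr a1 \<le> measure \<nu> (R' \<times> F)"
      "\<And>E. E \<in> sets M1 \<Longrightarrow> E \<subseteq> R \<Longrightarrow>
       measure \<nu> ((E - R') \<times> F) \<le> c1 * (measure M1 E powr a1 - measure M1 (E \<inter> R') powr a1)"
      using row_cut[OF sets_\<nu> R(1) F(1) \<open>emeasure M1 R < top\<close> fin[OF R(1) F(1) R(2) F(2)] a1 c(1)] by blast
    have R'A: "R' \<subseteq> A" using R R' by auto
    obtain F' where F': "F' \<in> sets M2" "F' \<subseteq> F" "c2 * measure M2 F' powr a2 \<le> measure \<nu> (R' \<times> F')"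
      "\<And>H. H \<in> sets M2 \<Longrightarrow> H \<subseteq> F \<Longrightarrow>
       measure \<nu> (R' \<times> (H - F')) \<le> c2 * (measure M2 H powr a2 - measure M2 (H \<inter> F') powr a2)"
      using column_cut[OF sets_\<nu> R'(1) F(1) \<open>emeasure M2 F < top\<close> fin[OF R'(1) F(1) R'A F(2)] a2 c(2)] by blast
    have "P (R', F')" "Q RF (R', F')" using R' F' R F R'A by (auto simp: P_def Q_def RF)
    then show ?thesis by blast
  qed
  have "\<exists>f. f 0 = (A, B) \<and> (\<forall>n. P (f n) \<and> Q (f n) (f (Suc n)))"
  proof -
    have "\<exists>f. \<forall>n. (P (f n) \<and> (n = 0 \<longrightarrow> f n = (A, B))) \<and> Q (f n) (f (Suc n))"
    proof (rule dependent_nat_choice)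
      show "\<exists>x. P x \<and> (0 = (0::nat) \<longrightarrow> x = (A, B))" using A B by (auto simp: P_def)
    qed (use step in auto)
    then show ?thesis by blast
  qed
  then obtain f where f: "f 0 = (A, B)" "\<And>n. P (f n)" "\<And>n. Q (f n) (f (Suc n))" by blast
  define R where "R n = fst (f n)" for n
  define F where "F n = snd (f n)" for n
  have R0: "R 0 = A" "F 0 = B" using f(1) by (auto simp: R_def F_def)
  have RF: "R n \<in> sets M1" "R n \<subseteq> A" "F n \<in> sets M2" "F n \<subseteq> B" for n
    using f(2)[of n] by (auto simp: P_def R_def F_def split: prod.splits)
  have dec: "R (Suc n) \<subseteq> R n" "F (Suc n) \<subseteq> F n"
    and exc1: "c1 * measure M1 (R (Suc n)) powr a1 \<le> measure \<nu> (R (Suc n) \<times> F n)"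
    and cut1: "\<And>E. E \<in> sets M1 \<Longrightarrow> E \<subseteq> R n \<Longrightarrow> measure \<nu> ((E - R (Suc n)) \<times> F n)
        \<le> c1 * (measure M1 E powr a1 - measure M1 (E \<inter> R (Suc n)) powr a1)"
    and exc2: "c2 * measure M2 (F (Suc n)) powr a2 \<le> measure \<nu> (R (Suc n) \<times> F (Suc n))"
    and cut2: "\<And>H. H \<in> sets M2 \<Longrightarrow> H \<subseteq> F n \<Longrightarrow> measure \<nu> (R (Suc n) \<times> (H - F (Suc n)))
        \<le> c2 * (measure M2 H powr a2 - measure M2 (H \<inter> F (Suc n)) powr a2)" for n
    using f(3)[of n] by (auto simp: Q_def R_def F_def split: prod.splits)
  have antiR: "R n \<subseteq> R m" if "m \<le> n" for m n
    using decseq_SucI[of R, OF dec(1)] that by (auto simp: decseq_def)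
  define x where "x n = measure M1 (R n) powr a1" for n
  define y where "y n = measure M2 (F n) powr a2" for n
  have xy: "2 * \<tau> * x (Suc n) \<le> y n" for n
  proof (rule excess_set_small[OF \<theta> \<Lambda> \<tau>])
    show "2 * \<Lambda> * \<tau> powr \<theta> * x (Suc n) \<le> \<Lambda> * x (Suc n) powr (1 - \<theta>) * y n powr \<theta>"
      using exc1[of n] bound'[OF RF(1,3,2,4), of "Suc n" n] by (simp add: c1_def x_def y_def)
  qed (auto simp: x_def y_def)
  have yx: "2 * (1 / \<tau>) * y (Suc n) \<le> x (Suc n)" for n
  proof (rule excess_set_small[of "1 - \<theta>" \<Lambda>])
    have "(1 / \<tau>) powr (1 - \<theta>) = \<tau> powr (\<theta> - 1)"
      using \<tau> by (simp add: powr_divide powr_minus_divide[symmetric])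
    then show "2 * \<Lambda> * (1 / \<tau>) powr (1 - \<theta>) * y (Suc n)
        \<le> \<Lambda> * y (Suc n) powr (1 - (1 - \<theta>)) * x (Suc n) powr (1 - \<theta>)"
      using exc2[of n] bound'[OF RF(1,3,2,4), of "Suc n" "Suc n"]
      by (simp add: c2_def x_def y_def mult_ac)
  qed (use \<theta> \<Lambda> \<tau> in \<open>auto simp: x_def y_def\<close>)
  have y_decay: "y n \<le> y 0 * (1/4)^n" for n
  proof (induction n)
    case (Suc n)
    have "2 * y (Suc n) \<le> \<tau> * x (Suc n)" using yx[of n] \<tau> by (simp add: field_simps)
    then have "4 * y (Suc n) \<le> y n" using xy[of n] by simp
    then show ?case using Suc by simp
  qed simp
  \<comment> \<open>The rows that survive all cuts form a null set.\<close>
  define Rinf where "Rinf = (\<Inter>n. R n)"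
  have Rinf: "Rinf \<in> sets M1" "Rinf \<subseteq> A" using RF(1) R0(1) by (auto simp: Rinf_def)
  have "measure M1 Rinf powr a1 \<le> 0"
  proof (rule LIMSEQ_le_const)
    have "(\<lambda>n. y 0 * (1/4)^n / (2 * \<tau>)) \<longlonglongrightarrow> y 0 * 0 / (2 * \<tau>)"
      using \<tau> by (intro tendsto_intros LIMSEQ_power_zero) auto
    then show "(\<lambda>n. y 0 * (1/4)^n / (2 * \<tau>)) \<longlonglongrightarrow> 0" by simp
    have "measure M1 Rinf powr a1 \<le> y 0 * (1/4)^n / (2 * \<tau>)" for n
    proof -
      have "emeasure M1 (R (Suc n)) < top"
        using A RF[of "Suc n"] emeasure_mono[of "R (Suc n)" A M1] by auto
      then have "measure M1 Rinf \<le> measure M1 (R (Suc n))"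
        using Rinf RF by (intro measure_mono_fmeasurable) (auto simp: Rinf_def fmeasurable_def)
      then have "measure M1 Rinf powr a1 \<le> x (Suc n)"
        unfolding x_def using a1 by (intro powr_mono2) auto
      also have "\<dots> \<le> y n / (2 * \<tau>)" using xy[of n] \<tau> by (simp add: field_simps)
      also have "\<dots> \<le> y 0 * (1/4)^n / (2 * \<tau>)" using y_decay[of n] \<tau> by (intro divide_right_mono) auto
      finally show ?thesis .
    qed
    then show "\<exists>N. \<forall>n\<ge>N. measure M1 Rinf powr a1 \<le> y 0 * (1/4)^n / (2 * \<tau>)" by blast
  qed
  then have "measure M1 Rinf = 0" by (metis order_antisym powr_eq_0_iff powr_ge_zero)
  then have null: "emeasure \<nu> (Rinf \<times> B) = 0"
    using bound[OF Rinf(1) B(1) Rinf(2) order_refl] a1 \<theta> by simp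
  define S where "S = (\<Union>k. (R k - R (Suc k)) \<times> F k)"
  have S: "S \<in> sets (M1 \<Otimes>\<^sub>M M2)" unfolding S_def using RF by (intro sets.countable_UN) auto
  show thesis
  proof (rule that[OF S])
    fix E assume E: "E \<in> sets M1" "E \<subseteq> A"
    define T where "T k = (E \<inter> R k - R (Suc k)) \<times> F k" for k
    have T: "T k \<in> sets \<nu>" for k using E RF by (auto simp: T_def sets_\<nu>)
    have sum: "(\<Sum>k<n. measure \<nu> (T k)) \<le> c1 * (measure M1 E powr a1 - measure M1 (E \<inter> R n) powr a1)" for n
    proof (induction n)
      case 0
      then show ?case using E R0 by (simp add: Int_absorb2)
    next
      case (Suc n)
      have "measure \<nu> (T n) \<le> c1 * (measure M1 (E \<inter> R n) powr a1 - measure M1 (E \<inter> R (Suc n)) powr a1)"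
        using cut1[of "E \<inter> R n" n] E RF dec(1)[of n] unfolding T_def
        by (simp add: Int_assoc Int_absorb1)
      then show ?case using Suc by (simp add: algebra_simps)
    qed
    have "(E \<times> B) \<inter> S \<subseteq> (\<Union>k. T k)" by (auto simp: S_def T_def)
    then have "emeasure \<nu> ((E \<times> B) \<inter> S) \<le> emeasure \<nu> (\<Union>k. T k)"
      using T by (intro emeasure_mono) auto
    also have "\<dots> \<le> (\<Sum>k. emeasure \<nu> (T k))"
      using T by (intro emeasure_subadditive_countably) auto
    also have "\<dots> \<le> ennreal (c1 * measure M1 E powr a1)"
    proof (rule suminf_le_const[OF summableI])
      fix n
      have "emeasure \<nu> (T k) = ennreal (measure \<nu> (T k))" for k
        unfolding T_def using E RF by (intro emeasure_eq_ennreal_measure less_imp_neq fin) auto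
      then have "(\<Sum>k<n. emeasure \<nu> (T k)) = ennreal (\<Sum>k<n. measure \<nu> (T k))"
        by (simp add: sum_ennreal)
      also have "\<dots> \<le> ennreal (c1 * measure M1 E powr a1)"
        using sum[of n] mult_nonneg_nonneg[OF c(1) powr_ge_zero[of "measure M1 (E \<inter> R n)" a1]]
        by (intro ennreal_leI) (simp add: right_diff_distrib)
      finally show "(\<Sum>k<n. emeasure \<nu> (T k)) \<le> ennreal (c1 * measure M1 E powr a1)" .
    qed
    finally show "emeasure \<nu> ((E \<times> B) \<inter> S) \<le> ennreal (2 * \<Lambda> * \<tau> powr \<theta> * measure M1 E powr a1)"
      by (simp add: c1_def)
  next
    fix H assume H: "H \<in> sets M2" "H \<subseteq> B"
    define T where "T k = R (Suc k) \<times> (H \<inter> F k - F (Suc k))" for k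
    have T: "T k \<in> sets \<nu>" for k using H RF by (auto simp: T_def sets_\<nu>)
    have sum: "(\<Sum>k<n. measure \<nu> (T k)) \<le> c2 * (measure M2 H powr a2 - measure M2 (H \<inter> F n) powr a2)" for n
    proof (induction n)
      case 0
      then show ?case using H R0 by (simp add: Int_absorb2)
    next
      case (Suc n)
      have "measure \<nu> (T n) \<le> c2 * (measure M2 (H \<inter> F n) powr a2 - measure M2 (H \<inter> F (Suc n)) powr a2)"
        using cut2[of "H \<inter> F n" n] H RF dec(2)[of n] unfolding T_def
        by (simp add: Int_assoc Int_absorb1)
      then show ?case using Suc by (simp add: algebra_simps)
    qed
    have "(A \<times> H) - S \<subseteq> (\<Union>k. T k) \<union> Rinf \<times> B"
    proof (rule subsetI)
      fix z assume "z \<in> (A \<times> H) - S"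
      then obtain i j where z: "z = (i, j)" and ij: "i \<in> A" "j \<in> H" "(i, j) \<notin> S" by auto
      show "z \<in> (\<Union>k. T k) \<union> Rinf \<times> B"
      proof (cases "i \<in> Rinf")
        case True
        then show ?thesis using ij H z by auto
      next
        case False
        then have ex: "\<exists>k. i \<notin> R k" by (auto simp: Rinf_def)
        \<comment> \<open>Row \<open>i\<close> is discarded at step \<open>k - 1\<close>. Since \<open>(i, j)\<close> is not in \<open>S\<close>, column \<open>j\<close> is already gone.\<close>
        define k where "k = (LEAST k. i \<notin> R k)"
        have "i \<notin> R k" using LeastI_ex[OF ex] by (simp add: k_def)
        then have "k \<noteq> 0" using ij R0 by (metis)
        then obtain k' where k': "k = Suc k'" using not0_implies_Suc by blast
        then have "i \<in> R k'" using not_less_Least[of k' "\<lambda>k. i \<notin> R k"] k_def by auto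
        then have "j \<notin> F k'" using ij \<open>i \<notin> R k\<close> k' by (auto simp: S_def)
        then have ex': "\<exists>l. j \<notin> F l" by auto
        define l where "l = (LEAST l. j \<notin> F l)"
        have "l \<le> k'" using \<open>j \<notin> F k'\<close> by (auto simp: l_def intro: Least_le)
        have "j \<notin> F l" using LeastI_ex[OF ex'] by (simp add: l_def)
        then have "l \<noteq> 0" using ij R0 H by (metis subsetD)
        then obtain l' where l': "l = Suc l'" using not0_implies_Suc by blast
        then have "j \<in> F l'" using not_less_Least[of l' "\<lambda>l. j \<notin> F l"] l_def by auto
        moreover have "i \<in> R (Suc l')" using antiR[OF \<open>l \<le> k'\<close>] \<open>i \<in> R k'\<close> l' by auto
        ultimately have "(i, j) \<in> T l'" using ij \<open>j \<notin> F l\<close> l' by (auto simp: T_def)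
        then show ?thesis using z by blast
      qed
    qed
    then have "emeasure \<nu> ((A \<times> H) - S) \<le> emeasure \<nu> ((\<Union>k. T k) \<union> Rinf \<times> B)"
      using T Rinf B by (intro emeasure_mono) (auto simp: sets_\<nu>)
    also have "\<dots> \<le> emeasure \<nu> (\<Union>k. T k) + emeasure \<nu> (Rinf \<times> B)"
      using T Rinf B by (intro emeasure_subadditive) (auto simp: sets_\<nu>)
    also have "\<dots> = emeasure \<nu> (\<Union>k. T k)" by (simp add: null)
    also have "\<dots> \<le> (\<Sum>k. emeasure \<nu> (T k))"
      using T by (intro emeasure_subadditive_countably) auto
    also have "\<dots> \<le> ennreal (c2 * measure M2 H powr a2)"
    proof (rule suminf_le_const[OF summableI])
      fix n
      have "emeasure \<nu> (T k) = ennreal (measure \<nu> (T k))" for k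
        unfolding T_def using H RF by (intro emeasure_eq_ennreal_measure less_imp_neq fin) auto
      then have "(\<Sum>k<n. emeasure \<nu> (T k)) = ennreal (\<Sum>k<n. measure \<nu> (T k))"
        by (simp add: sum_ennreal)
      also have "\<dots> \<le> ennreal (c2 * measure M2 H powr a2)"
        using sum[of n] mult_nonneg_nonneg[OF c(2) powr_ge_zero[of "measure M2 (H \<inter> F n)" a2]]
        by (intro ennreal_leI) (simp add: right_diff_distrib)
      finally show "(\<Sum>k<n. emeasure \<nu> (T k)) \<le> ennreal (c2 * measure M2 H powr a2)" .
    qed
    finally show "emeasure \<nu> ((A \<times> H) - S) \<le> ennreal (2 * \<Lambda> * \<tau> powr (\<theta> - 1) * measure M2 H powr a2)"
      by (simp add: c2_def)
  qed
qed

section \<open>A common element of a decreasing sequence of convex sets\<close>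

text \<open>A substitute for weak compactness that takes place in \<open>L\<^sub>2\<close>. The infima \<open>d n\<close> of \<open>\<integral> v\<^sup>2\<close> over \<open>K n\<close> increase to
  a finite limit. For large \<open>n\<close>, two elements of \<open>K n\<close> with \<open>\<integral> v\<^sup>2\<close> close to that limit have their midpoint in \<open>K n\<close>, so the
  parallelogram law makes them close to each other. A sequence of near minimisers, chosen with geometric
  rates, is therefore summably Cauchy and converges almost everywhere.\<close>
lemma decseq_midpoint_convex_Inter_nonempty:
  fixes K :: "nat \<Rightarrow> ('a \<Rightarrow> real) set"
  assumes P: "finite_measure P"
    and meas: "\<And>n v. v \<in> K n \<Longrightarrow> v \<in> borel_measurable P"
    and unit: "\<And>n v x. v \<in> K n \<Longrightarrow> 0 \<le> v x \<and> v x \<le> 1"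
    and ne: "\<And>n. K n \<noteq> {}" and dec: "\<And>n. K (Suc n) \<subseteq> K n"
    and mid: "\<And>n u v. u \<in> K n \<Longrightarrow> v \<in> K n \<Longrightarrow> (\<lambda>x. (u x + v x) / 2) \<in> K n"
    and closed: "\<And>n u v. (\<And>i. u i \<in> K n) \<Longrightarrow> v \<in> borel_measurable P \<Longrightarrow>
        (\<And>x. 0 \<le> v x \<and> v x \<le> 1) \<Longrightarrow> (AE x in P. (\<lambda>i. u i x) \<longlonglongrightarrow> v x) \<Longrightarrow> v \<in> K n"
  obtains v where "\<And>n. v \<in> K n"
proof -
  interpret finite_measure P by fact
  have K_anti: "K n \<subseteq> K m" if "m \<le> n" for m n
    using decseq_SucI[of K, OF dec] that by (auto simp: decseq_def)
  have int_sq: "integrable P (\<lambda>x. v x ^ 2)" if "v \<in> K n" for v n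
    using meas[OF that] unit[OF that] by (intro integrable_const_bound[where B=1]) (auto intro: power_le_one)
  define e where "e v = (\<integral>x. v x ^ 2 \<partial>P)" for v :: "'a \<Rightarrow> real"
  define d where "d n = Inf (e ` K n)" for n
  have e_nonneg: "0 \<le> e v" for v by (simp add: e_def)
  have bdd: "bdd_below (e ` K n)" for n using e_nonneg by (intro bdd_belowI2) auto
  have d_le: "d n \<le> e v" if "v \<in> K n" for n v
    unfolding d_def using bdd that by (intro cINF_lower)
  have "d n \<le> measure P (space P)" for n
  proof -
    obtain v where v: "v \<in> K n" using ne by blast
    have "e v \<le> (\<integral>x. 1 \<partial>P)"
      unfolding e_def using int_sq[OF v] unit[OF v] by (intro integral_mono) (auto intro: power_le_one)
    then show ?thesis using d_le[OF v] by simp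
  qed
  moreover have d_mono: "incseq d"
  proof (rule incseq_SucI)
    show "d n \<le> d (Suc n)" for n
      unfolding d_def using ne bdd dec by (intro cINF_superset_mono) auto
  qed
  ultimately obtain D where D: "d \<longlonglongrightarrow> D" "\<And>n. d n \<le> D"
    using incseq_convergent[of d "measure P (space P)"] by auto
  have "\<exists>n. D - (1/4)^k < d n" for k :: nat
    using order_tendstoD(1)[OF D(1), of "D - (1/4)^k"] by (auto simp: eventually_sequentially)
  then obtain n0 where n0: "D - (1/4)^k < d (n0 k)" for k :: nat by metis
  \<comment> \<open>The sum makes \<open>n\<close> monotone and at least \<open>n0\<close>, the summand \<open>k\<close> makes it unbounded.\<close>
  define n where "n k = k + (\<Sum>i\<le>k. n0 i)" for k
  have n_ge: "k \<le> n k" for k by (simp add: n_def)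
  have n_mono: "n k \<le> n (Suc k)" for k by (simp add: n_def)
  have "n0 k \<le> n k" for k by (simp add: n_def trans_le_add2 member_le_sum)
  then have dn: "D - (1/4)^k < d (n k)" for k
    using n0[of k] d_mono by (meson incseqD less_le_trans)
  have "\<exists>v\<in>K (n k). e v < D + (1/4)^k" for k
  proof -
    have "d (n k) < D + (1/4)^k" using D(2)[of "n k"] by (smt (verit) zero_less_power zero_less_divide_iff)
    then show ?thesis using cINF_less_iff[OF ne bdd] by (auto simp: d_def)
  qed
  then obtain v where v: "v k \<in> K (n k)" "e (v k) < D + (1/4)^k" for k by metis
  have v_meas [measurable]: "v k \<in> borel_measurable P" for k using meas[OF v(1)] .
  have v_unit: "0 \<le> v k x \<and> v k x \<le> 1" for k x using unit[OF v(1)] .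
  have close: "(\<integral>x. (v k x - v (Suc k) x)^2 \<partial>P) \<le> 8 * (1/4)^k" for k
  proof -
    let ?m = "\<lambda>x. (v k x + v (Suc k) x) / 2"
    have vS: "v (Suc k) \<in> K (n k)" using v(1)[of "Suc k"] K_anti[OF n_mono[of k]] by blast
    have m: "?m \<in> K (n k)" using mid[OF v(1) vS] .
    have "(\<integral>x. (v k x - v (Suc k) x)^2 \<partial>P) = (\<integral>x. 2 * v k x ^ 2 + 2 * v (Suc k) x ^ 2 - 4 * ?m x ^ 2 \<partial>P)"
      by (intro Bochner_Integration.integral_cong) (auto simp: power2_eq_square field_simps)
    also have "\<dots> = 2 * e (v k) + 2 * e (v (Suc k)) - 4 * e ?m"
      unfolding e_def using int_sq[OF v(1)[of k]] int_sq[OF vS] int_sq[OF m] by simp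
    also have "\<dots> \<le> 8 * (1/4)^k"
      using d_le[OF m] dn[of k] v(2)[of k] v(2)[of "Suc k"]
        zero_le_power[of "1/4::real" k] by (simp del: zero_le_power)
    finally show ?thesis .
  qed
  have L1: "(\<integral>\<^sup>+x. ennreal \<bar>v k x - v (Suc k) x\<bar> \<partial>P) \<le> ennreal ((measure P (space P) + 8) * (1/2)^k)" for k
  proof -
    let ?w = "\<lambda>x. v k x - v (Suc k) x"
    have wb: "\<bar>?w x\<bar> \<le> 1" for x using v_unit[of k x] v_unit[of "Suc k" x] by linarith
    have int: "integrable P (\<lambda>x. \<bar>?w x\<bar>)" "integrable P (\<lambda>x. ?w x ^ 2)"
      using wb by (auto intro!: integrable_const_bound[where B=1] simp: abs_square_le_1)
    \<comment> \<open>The weights turn the bound \<open>8 * 4 powr -k\<close> for the square into one of order \<open>2 powr -k\<close> for the modulus.\<close>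
    have le: "\<bar>w\<bar> \<le> (1/2)^k + 2^k * w^2" for w :: real
    proof -
      have "0 \<le> 2^k * (\<bar>w\<bar> - (1/2)^k)^2" by simp
      also have "\<dots> = 2^k * w^2 - 2 * \<bar>w\<bar> + (1/2)^k"
        by (simp add: power2_eq_square field_simps)
      finally show ?thesis by simp
    qed
    have "(\<integral>x. \<bar>?w x\<bar> \<partial>P) \<le> (\<integral>x. (1/2)^k + 2^k * ?w x ^ 2 \<partial>P)"
      using int le by (intro integral_mono) auto
    also have "\<dots> = (1/2)^k * measure P (space P) + 2^k * (\<integral>x. ?w x ^ 2 \<partial>P)"
      using int by simp
    also have "\<dots> \<le> (1/2)^k * measure P (space P) + 2^k * (8 * (1/4)^k)"
      using close[of k] by (intro add_left_mono mult_left_mono) auto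
    also have "2^k * (8 * (1/4)^k) = 8 * (1/2::real)^k"
      by (simp flip: power_mult_distrib)
    finally have "(\<integral>x. \<bar>?w x\<bar> \<partial>P) \<le> (measure P (space P) + 8) * (1/2)^k"
      by (simp add: algebra_simps)
    then show ?thesis using int by (simp add: nn_integral_eq_integral ennreal_leI)
  qed
  have "(\<integral>\<^sup>+x. (\<Sum>k. ennreal \<bar>v k x - v (Suc k) x\<bar>) \<partial>P) = (\<Sum>k. \<integral>\<^sup>+x. ennreal \<bar>v k x - v (Suc k) x\<bar> \<partial>P)"
    by (intro nn_integral_suminf) measurable
  also have "\<dots> \<le> (\<Sum>k. ennreal ((measure P (space P) + 8) * (1/2)^k))"
    using L1 by (intro suminf_le summableI)
  also have "\<dots> < top"
    by (subst less_top[symmetric], intro ennreal_suminf_neq_top summable_mult summable_geometric) auto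
  finally have "AE x in P. (\<Sum>k. ennreal \<bar>v k x - v (Suc k) x\<bar>) \<noteq> \<infinity>"
    by (intro nn_integral_PInf_AE) auto
  then have conv: "AE x in P. convergent (\<lambda>k. v k x)"
  proof eventually_elim
    fix x assume "(\<Sum>k. ennreal \<bar>v k x - v (Suc k) x\<bar>) \<noteq> \<infinity>"
    then have "summable (\<lambda>k. \<bar>v k x - v (Suc k) x\<bar>)"
      by (intro summable_suminf_not_top) auto
    then have "summable (\<lambda>k. v k x - v (Suc k) x)" by (rule summable_rabs_cancel)
    then have "convergent (\<lambda>m. \<Sum>k<m. v k x - v (Suc k) x)" by (simp add: summable_iff_convergent)
    then have "convergent (\<lambda>m. v 0 x - (\<Sum>k<m. v k x - v (Suc k) x))"
      by (intro convergent_diff convergent_const)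
    moreover have "v 0 x - (\<Sum>k<m. v k x - v (Suc k) x) = v m x" for m
      using sum_lessThan_telescope'[of "\<lambda>k. v k x" m] by simp
    ultimately show "convergent (\<lambda>k. v k x)" by simp
  qed
  define w where "w x = (if convergent (\<lambda>k. v k x) then lim (\<lambda>k. v k x) else 0)" for x
  have w_meas: "w \<in> borel_measurable P"
    unfolding w_def Cauchy_convergent_iff[symmetric] by measurable
  have w_unit: "0 \<le> w x \<and> w x \<le> 1" for x
  proof (cases "convergent (\<lambda>k. v k x)")
    case True
    then have "(\<lambda>k. v k x) \<longlonglongrightarrow> w x" by (simp add: w_def convergent_LIMSEQ_iff)
    then show ?thesis using v_unit LIMSEQ_le_const LIMSEQ_le_const2 by meson
  qed (simp add: w_def)
  show thesis
  proof (rule that[of w], rule closed[of "\<lambda>i. v (i + m)" m w for m])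
    fix m i
    show "v (i + m) \<in> K m"
      using v(1)[of "i + m"] K_anti[of m "n (i + m)"] n_ge[of "i + m"] by auto
  next
    show "AE x in P. (\<lambda>i. v (i + m) x) \<longlonglongrightarrow> w x" for m
      using conv by eventually_elim (auto simp: w_def convergent_LIMSEQ_iff intro: LIMSEQ_ignore_initial_segment)
  qed (use w_meas w_unit in auto)
qed

section \<open>Cutting a sigma-finite product\<close>

text \<open>Exhaust the product by rectangles \<open>A n \<times> B n\<close> of finite measure. \<open>K n\<close> consists of the functions \<open>v\<close> with values
  in \<open>[0,1]\<close> for which \<open>v\<close> and \<open>1 - v\<close>, restricted to this rectangle, satisfy the row and the column bound. It
  contains the indicator of the set from \<open>block_decomposition\<close>, and it is closed under almost everywhere
  limits by Fatou's lemma. Passing from a common element \<open>v\<close> of all \<open>K n\<close> to \<open>{v \<ge> 1/2}\<close> costs another factor 2.\<close>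
lemma (in pair_sigma_finite) product_decomposition:
  fixes g :: "'a \<times> 'b \<Rightarrow> ennreal"
  defines "\<nu> \<equiv> density (M1 \<Otimes>\<^sub>M M2) g"
  assumes g: "g \<in> borel_measurable (M1 \<Otimes>\<^sub>M M2)"
    and \<theta>: "0 < \<theta>" "\<theta> < 1" and a1: "0 < a1" "a1 \<le> 1" and a2: "0 < a2" "a2 \<le> 1"
    and \<Lambda>: "0 < \<Lambda>" and \<tau>: "0 < \<tau>"
    and bound: "\<And>E F. E \<in> sets M1 \<Longrightarrow> F \<in> sets M2 \<Longrightarrow> emeasure M1 E < top \<Longrightarrow> emeasure M2 F < top \<Longrightarrow>
      emeasure \<nu> (E \<times> F) \<le>
        ennreal (\<Lambda> * measure M1 E powr ((1 - \<theta>) * a1) * measure M2 F powr (\<theta> * a2))"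
  obtains W where "W \<in> sets (M1 \<Otimes>\<^sub>M M2)"
    "\<And>E. E \<in> sets M1 \<Longrightarrow> emeasure M1 E < top \<Longrightarrow>
       emeasure \<nu> ((E \<times> space M2) \<inter> W) \<le> ennreal (4 * \<Lambda> * \<tau> powr \<theta> * measure M1 E powr a1)"
    "\<And>F. F \<in> sets M2 \<Longrightarrow> emeasure M2 F < top \<Longrightarrow>
       emeasure \<nu> ((space M1 \<times> F) - W) \<le> ennreal (4 * \<Lambda> * \<tau> powr (\<theta> - 1) * measure M2 F powr a2)"
proof -
  define c1 where "c1 = 2 * \<Lambda> * \<tau> powr \<theta>"
  define c2 where "c2 = 2 * \<Lambda> * \<tau> powr (\<theta> - 1)"
  have c: "0 \<le> c1" "0 \<le> c2" using \<Lambda> by (auto simp: c1_def c2_def)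
  have sets_\<nu> [simp, measurable_cong]: "sets \<nu> = sets (M1 \<Otimes>\<^sub>M M2)" by (simp add: \<nu>_def)
  have space_\<nu> [simp]: "space \<nu> = space M1 \<times> space M2" by (simp add: \<nu>_def space_pair_measure)
  obtain A where A: "range A \<subseteq> sets M1" "(\<Union>i. A i) = space M1" "\<And>i. emeasure M1 (A i) \<noteq> \<infinity>" "incseq A"
    using M1.sigma_finite_incseq by blast
  obtain B where B: "range B \<subseteq> sets M2" "(\<Union>i. B i) = space M2" "\<And>i. emeasure M2 (B i) \<noteq> \<infinity>" "incseq B"
    using M2.sigma_finite_incseq by blast
  have A' [measurable]: "A n \<in> sets M1" and A_fin: "emeasure M1 (A n) < top" for n
    using A by (auto simp: less_top)
  have B' [measurable]: "B n \<in> sets M2" and B_fin: "emeasure M2 (B n) < top" for n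
    using B by (auto simp: less_top)
  have A_sub: "A n \<subseteq> A (Suc n)" and B_sub: "B n \<subseteq> B (Suc n)" for n
    using A(4) B(4) by (simp_all add: incseq_SucD)
  define K where "K n = {v \<in> borel_measurable (M1 \<Otimes>\<^sub>M M2). (\<forall>z. 0 \<le> v z \<and> v z \<le> 1)
     \<and> (\<forall>E\<in>sets M1. E \<subseteq> A n \<longrightarrow>
          (\<integral>\<^sup>+z. ennreal (v z) * indicator (E \<times> B n) z \<partial>\<nu>) \<le> ennreal (c1 * measure M1 E powr a1))
     \<and> (\<forall>F\<in>sets M2. F \<subseteq> B n \<longrightarrow>
          (\<integral>\<^sup>+z. ennreal (1 - v z) * indicator (A n \<times> F) z \<partial>\<nu>) \<le> ennreal (c2 * measure M2 F powr a2))}"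
    for n
  have KD: "v \<in> borel_measurable (M1 \<Otimes>\<^sub>M M2)" "0 \<le> v z" "v z \<le> 1"
    "E \<in> sets M1 \<Longrightarrow> E \<subseteq> A n \<Longrightarrow>
       (\<integral>\<^sup>+z. ennreal (v z) * indicator (E \<times> B n) z \<partial>\<nu>) \<le> ennreal (c1 * measure M1 E powr a1)"
    "F \<in> sets M2 \<Longrightarrow> F \<subseteq> B n \<Longrightarrow>
       (\<integral>\<^sup>+z. ennreal (1 - v z) * indicator (A n \<times> F) z \<partial>\<nu>) \<le> ennreal (c2 * measure M2 F powr a2)"
    if "v \<in> K n" for v n z E F
    using that unfolding K_def by blast+
  have K_ne: "K n \<noteq> {}" for n
  proof -
    obtain S where S [measurable]: "S \<in> sets (M1 \<Otimes>\<^sub>M M2)" 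
      and S1: "\<And>E. E \<in> sets M1 \<Longrightarrow> E \<subseteq> A n \<Longrightarrow>
        emeasure \<nu> ((E \<times> B n) \<inter> S) \<le> ennreal (c1 * measure M1 E powr a1)"
      and S2: "\<And>F. F \<in> sets M2 \<Longrightarrow> F \<subseteq> B n \<Longrightarrow>
        emeasure \<nu> ((A n \<times> F) - S) \<le> ennreal (c2 * measure M2 F powr a2)"
    proof (rule block_decomposition[where A="A n" and B="B n",
          OF sets_\<nu> A' A_fin B' B_fin \<theta> a1 a2 \<Lambda> \<tau>])
      fix E F assume EF: "E \<in> sets M1" "F \<in> sets M2" "E \<subseteq> A n" "F \<subseteq> B n"
      then have "emeasure M1 E < top" "emeasure M2 F < top"
        using A_fin[of n] B_fin[of n] A' B'
        by (metis emeasure_mono order_le_less_trans)+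
      then show "emeasure \<nu> (E \<times> F)
          \<le> ennreal (\<Lambda> * measure M1 E powr ((1 - \<theta>) * a1) * measure M2 F powr (\<theta> * a2))"
        using EF by (intro bound)
    qed (auto simp: c1_def c2_def)
    have "(indicator S :: _ \<Rightarrow> real) \<in> K n"
      unfolding K_def mem_Collect_eq
    proof (intro conjI ballI impI allI)
      fix E assume E: "E \<in> sets M1" "E \<subseteq> A n"
      have "(\<integral>\<^sup>+z. ennreal (indicator S z) * indicator (E \<times> B n) z \<partial>\<nu>) = (\<integral>\<^sup>+z. indicator ((E \<times> B n) \<inter> S) z \<partial>\<nu>)"
        by (intro nn_integral_cong) (auto simp: indicator_def)
      also have "\<dots> = emeasure \<nu> ((E \<times> B n) \<inter> S)"
        using E by (intro nn_integral_indicator) auto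
      finally show "(\<integral>\<^sup>+z. ennreal (indicator S z) * indicator (E \<times> B n) z \<partial>\<nu>) \<le> ennreal (c1 * measure M1 E powr a1)"
        using S1[OF E] by simp
    next
      fix F assume F: "F \<in> sets M2" "F \<subseteq> B n"
      have "(\<integral>\<^sup>+z. ennreal (1 - indicator S z) * indicator (A n \<times> F) z \<partial>\<nu>) = (\<integral>\<^sup>+z. indicator ((A n \<times> F) - S) z \<partial>\<nu>)"
        by (intro nn_integral_cong) (auto simp: indicator_def)
      also have "\<dots> = emeasure \<nu> ((A n \<times> F) - S)"
        using F by (intro nn_integral_indicator) auto
      finally show "(\<integral>\<^sup>+z. ennreal (1 - indicator S z) * indicator (A n \<times> F) z \<partial>\<nu>) \<le> ennreal (c2 * measure M2 F powr a2)"
        using S2[OF F] by simp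
    qed (auto simp: indicator_def)
    then show ?thesis by blast
  qed
  \<comment> \<open>A finite measure with the same null sets as the product measure.\<close>
  obtain h where h: "h \<in> borel_measurable (M1 \<Otimes>\<^sub>M M2)" "(\<integral>\<^sup>+z. h z \<partial>(M1 \<Otimes>\<^sub>M M2)) \<noteq> \<infinity>"
      "\<forall>z\<in>space (M1 \<Otimes>\<^sub>M M2). 0 < h z \<and> h z < \<infinity>"
    using Ex_finite_integrable_function by blast
  define P where "P = density (M1 \<Otimes>\<^sub>M M2) h"
  have sets_P [simp, measurable_cong]: "sets P = sets (M1 \<Otimes>\<^sub>M M2)" by (simp add: P_def)
  have fin_P: "finite_measure P"
    using h by (intro finite_measureI) (simp add: P_def emeasure_density cong: nn_integral_cong)
  have AE_P: "AE z in \<nu>. Q z" if "AE z in P. Q z" for Q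
  proof -
    have "AE z in M1 \<Otimes>\<^sub>M M2. 0 < h z \<longrightarrow> Q z"
      using that unfolding P_def AE_density[OF h(1)] .
    then have "AE z in M1 \<Otimes>\<^sub>M M2. Q z"
      using AE_space by eventually_elim (use h(3) in auto)
    then show ?thesis unfolding \<nu>_def AE_density[OF g] by (rule eventually_mono) auto
  qed
  obtain v where v: "\<And>n. v \<in> K n"
  proof (rule decseq_midpoint_convex_Inter_nonempty[OF fin_P, of K])
    show "\<And>n v. v \<in> K n \<Longrightarrow> v \<in> borel_measurable P"
      using KD(1) measurable_cong_sets[OF sets_P refl] by blast
    show "0 \<le> v z \<and> v z \<le> 1" if "v \<in> K n" for n v z using KD(2,3)[OF that] by blast
    show "K (Suc n) \<subseteq> K n" for n
    proof
      fix v assume v: "v \<in> K (Suc n)"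
      note [measurable] = KD(1)[OF v]
      show "v \<in> K n"
        unfolding K_def mem_Collect_eq
      proof (intro conjI ballI impI allI)
        fix E assume E: "E \<in> sets M1" "E \<subseteq> A n"
        have "(\<integral>\<^sup>+z. ennreal (v z) * indicator (E \<times> B n) z \<partial>\<nu>) \<le> (\<integral>\<^sup>+z. ennreal (v z) * indicator (E \<times> B (Suc n)) z \<partial>\<nu>)"
          using B_sub[of n] by (intro nn_integral_mono mult_left_mono) (auto simp: indicator_def)
        also have "\<dots> \<le> ennreal (c1 * measure M1 E powr a1)"
          using E A_sub[of n] by (intro KD(4)[OF v]) auto
        finally show "(\<integral>\<^sup>+z. ennreal (v z) * indicator (E \<times> B n) z \<partial>\<nu>) \<le> ennreal (c1 * measure M1 E powr a1)" .
      next
        fix F assume F: "F \<in> sets M2" "F \<subseteq> B n"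
        have "(\<integral>\<^sup>+z. ennreal (1 - v z) * indicator (A n \<times> F) z \<partial>\<nu>) \<le> (\<integral>\<^sup>+z. ennreal (1 - v z) * indicator (A (Suc n) \<times> F) z \<partial>\<nu>)"
          using A_sub[of n] by (intro nn_integral_mono mult_left_mono) (auto simp: indicator_def)
        also have "\<dots> \<le> ennreal (c2 * measure M2 F powr a2)"
          using F B_sub[of n] by (intro KD(5)[OF v]) auto
        finally show "(\<integral>\<^sup>+z. ennreal (1 - v z) * indicator (A n \<times> F) z \<partial>\<nu>) \<le> ennreal (c2 * measure M2 F powr a2)" .
      qed (use KD(1-3)[OF v] in auto)
    qed
    show "(\<lambda>z. (u z + w z) / 2) \<in> K n" if u: "u \<in> K n" and w: "w \<in> K n" for n u w
    proof -
      note [measurable] = KD(1)[OF u] KD(1)[OF w]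
      have half: "(\<integral>\<^sup>+z. ennreal ((f1 z + f2 z) / 2) * indicator X z \<partial>\<nu>) \<le> c"
        if "(\<integral>\<^sup>+z. ennreal (f1 z) * indicator X z \<partial>\<nu>) \<le> c" "(\<integral>\<^sup>+z. ennreal (f2 z) * indicator X z \<partial>\<nu>) \<le> c"
          and [measurable]: "f1 \<in> borel_measurable \<nu>" "f2 \<in> borel_measurable \<nu>" "X \<in> sets \<nu>"
          and "\<And>z. 0 \<le> f1 z" "\<And>z. 0 \<le> f2 z" for f1 f2 X c
      proof -
        have "(\<integral>\<^sup>+z. ennreal ((f1 z + f2 z) / 2) * indicator X z \<partial>\<nu>)
            = (\<integral>\<^sup>+z. ennreal (1/2) * (ennreal (f1 z) * indicator X z + ennreal (f2 z) * indicator X z) \<partial>\<nu>)"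
        proof (intro nn_integral_cong)
          fix z
          have "ennreal ((f1 z + f2 z) / 2) = ennreal (1/2) * (ennreal (f1 z) + ennreal (f2 z))"
            using that(6,7)[of z] ennreal_mult[of "1/2" "f1 z + f2 z"] by (simp only: ennreal_plus) simp
          then show "ennreal ((f1 z + f2 z) / 2) * indicator X z
            = ennreal (1/2) * (ennreal (f1 z) * indicator X z + ennreal (f2 z) * indicator X z)"
            by (simp only: distrib_right mult.assoc)
        qed
        also have "\<dots> = ennreal (1/2) * ((\<integral>\<^sup>+z. ennreal (f1 z) * indicator X z \<partial>\<nu>) + (\<integral>\<^sup>+z. ennreal (f2 z) * indicator X z \<partial>\<nu>))"
          by (simp add: nn_integral_cmult nn_integral_add)
        also have "\<dots> \<le> ennreal (1/2) * (c + c)" using that by (intro mult_left_mono add_mono) auto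
        also have "\<dots> = (ennreal (1/2) * ennreal 2) * c" by (simp add: mult_2 mult.assoc)
        also have "ennreal (1/2) * ennreal 2 = 1" by (subst ennreal_mult[symmetric]) auto
        finally show ?thesis by simp
      qed
      have eq: "1 - (u z + w z) / 2 = ((1 - u z) + (1 - w z)) / 2" for z by (simp add: field_simps)
      show ?thesis
        unfolding K_def mem_Collect_eq eq using KD[OF u] KD[OF w]
          add_mono[OF KD(3)[OF u] KD(3)[OF w]]
        by (intro conjI ballI impI allI half) (auto simp: add_increasing)
    qed
    show "w \<in> K n" if u: "\<And>i. u i \<in> K n" and w: "w \<in> borel_measurable P" "\<And>z. 0 \<le> w z \<and> w z \<le> 1"
      and lim: "AE z in P. (\<lambda>i. u i z) \<longlonglongrightarrow> w z" for n u w
    proof -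
      have w' [measurable]: "w \<in> borel_measurable (M1 \<Otimes>\<^sub>M M2)"
        using w(1) measurable_cong_sets[OF sets_P refl] by blast
      note [measurable] = KD(1)[OF u]
      have fatou: "(\<integral>\<^sup>+z. ennreal (f z) * indicator X z \<partial>\<nu>) \<le> c"
        if "\<And>i. (\<integral>\<^sup>+z. ennreal (fs i z) * indicator X z \<partial>\<nu>) \<le> c"
          and [measurable]: "\<And>i. fs i \<in> borel_measurable \<nu>" "X \<in> sets \<nu>"
          and "AE z in \<nu>. (\<lambda>i. fs i z) \<longlonglongrightarrow> f z" for f fs X c
      proof -
        have "(\<integral>\<^sup>+z. ennreal (f z) * indicator X z \<partial>\<nu>) = (\<integral>\<^sup>+z. liminf (\<lambda>i. ennreal (fs i z) * indicator X z) \<partial>\<nu>)"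
        proof (rule nn_integral_cong_AE)
          show "AE z in \<nu>. ennreal (f z) * indicator X z = liminf (\<lambda>i. ennreal (fs i z) * indicator X z)"
            using that(4)
          proof eventually_elim
            fix z assume "(\<lambda>i. fs i z) \<longlonglongrightarrow> f z"
            then have "(\<lambda>i. ennreal (fs i z) * indicator X z) \<longlonglongrightarrow> ennreal (f z) * indicator X z"
              by (auto simp: indicator_def intro!: tendsto_ennrealI)
            then show "ennreal (f z) * indicator X z = liminf (\<lambda>i. ennreal (fs i z) * indicator X z)"
              by (simp add: lim_imp_Liminf)
          qed
        qed
        also have "\<dots> \<le> liminf (\<lambda>i. \<integral>\<^sup>+z. ennreal (fs i z) * indicator X z \<partial>\<nu>)"
          by (intro nn_integral_liminf) measurable
        also have "\<dots> \<le> c" by (intro Liminf_le always_eventually allI that(1)) simp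
        finally show ?thesis .
      qed
      have lim1: "AE z in \<nu>. (\<lambda>i. u i z) \<longlonglongrightarrow> w z" using AE_P[OF lim] .
      then have lim2: "AE z in \<nu>. (\<lambda>i. 1 - u i z) \<longlonglongrightarrow> 1 - w z"
        by eventually_elim (intro tendsto_intros)
      show ?thesis
        unfolding K_def mem_Collect_eq
      proof (intro conjI ballI impI allI)
        fix E assume E: "E \<in> sets M1" "E \<subseteq> A n"
        then show "(\<integral>\<^sup>+z. ennreal (w z) * indicator (E \<times> B n) z \<partial>\<nu>) \<le> ennreal (c1 * measure M1 E powr a1)"
          by (intro fatou[of u, OF KD(4)[OF u] _ _ lim1]) auto
      next
        fix F assume F: "F \<in> sets M2" "F \<subseteq> B n"
        then show "(\<integral>\<^sup>+z. ennreal (1 - w z) * indicator (A n \<times> F) z \<partial>\<nu>) \<le> ennreal (c2 * measure M2 F powr a2)"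
          by (intro fatou[of "\<lambda>i z. 1 - u i z", OF KD(5)[OF u] _ _ lim2]) auto
      qed (use w in auto)
    qed
  qed (use K_ne in auto)
  note [measurable] = KD(1)[OF v]
  define W where "W = {z \<in> space (M1 \<Otimes>\<^sub>M M2). 1/2 \<le> v z}"
  have W [measurable]: "W \<in> sets (M1 \<Otimes>\<^sub>M M2)" unfolding W_def by measurable
  have double: "emeasure \<nu> X \<le> ennreal (2 * c)"
    if "(\<integral>\<^sup>+z. ennreal (f z) * indicator Y z \<partial>\<nu>) \<le> ennreal c" "X \<subseteq> Y" "\<And>z. z \<in> X \<Longrightarrow> 1/2 \<le> f z"
      and [measurable]: "X \<in> sets \<nu>" "Y \<in> sets \<nu>" "f \<in> borel_measurable \<nu>" for X Y f c
  proof -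
    have "emeasure \<nu> X = (\<integral>\<^sup>+z. indicator X z \<partial>\<nu>)" using that by simp
    also have "\<dots> \<le> (\<integral>\<^sup>+z. 2 * (ennreal (f z) * indicator Y z) \<partial>\<nu>)"
    proof (intro nn_integral_mono)
      fix z
      show "indicator X z \<le> 2 * (ennreal (f z) * indicator Y z)"
      proof (cases "z \<in> X")
        case True
        then have "ennreal 1 \<le> ennreal (2 * f z)" using that(3)[OF True] by (intro ennreal_leI) simp
        then show ?thesis using True that(2) by (auto simp: ennreal_mult')
      qed simp
    qed
    also have "\<dots> = 2 * (\<integral>\<^sup>+z. ennreal (f z) * indicator Y z \<partial>\<nu>)"
      using that by (intro nn_integral_cmult) measurable
    also have "\<dots> \<le> ennreal (2 * c)" using that(1) by (simp add: ennreal_mult' mult_left_mono)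
    finally show ?thesis .
  qed
  have AB_lim: "emeasure \<nu> X \<le> c" if "\<And>n. emeasure \<nu> (X \<inter> (A n \<times> B n)) \<le> c" "X \<in> sets \<nu>" for X c
  proof -
    have "X = (\<Union>n. X \<inter> (A n \<times> B n))"
    proof -
      have "space M1 \<times> space M2 = (\<Union>n. A n \<times> B n)"
        unfolding A(2)[symmetric] B(2)[symmetric]
      proof (intro antisym subsetI)
        fix z assume "z \<in> (\<Union> (range A)) \<times> (\<Union> (range B))"
        then obtain i j where "fst z \<in> A i" "snd z \<in> B j" by auto
        then have "fst z \<in> A (max i j)" "snd z \<in> B (max i j)"
          using incseqD[OF A(4), of i "max i j"] incseqD[OF B(4), of j "max i j"] by auto
        then show "z \<in> (\<Union>n. A n \<times> B n)" by (cases z) auto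
      qed auto
      then show ?thesis using sets.sets_into_space[OF that(2)] by auto
    qed
    moreover have "incseq (\<lambda>n. X \<inter> (A n \<times> B n))"
      using A_sub B_sub by (intro incseq_SucI) blast
    moreover have "range (\<lambda>n. X \<inter> (A n \<times> B n)) \<subseteq> sets \<nu>" using that by auto
    ultimately have "emeasure \<nu> X = (SUP n. emeasure \<nu> (X \<inter> (A n \<times> B n)))"
      using SUP_emeasure_incseq[of "\<lambda>n. X \<inter> (A n \<times> B n)" \<nu>] by simp
    then show ?thesis using that(1) by (auto intro: SUP_least)
  qed
  show thesis
  proof (rule that[OF W])
    fix E assume E: "E \<in> sets M1" "emeasure M1 E < top"
    show "emeasure \<nu> ((E \<times> space M2) \<inter> W) \<le> ennreal (4 * \<Lambda> * \<tau> powr \<theta> * measure M1 E powr a1)"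
    proof (rule AB_lim)
      fix n
      have le: "measure M1 (E \<inter> A n) \<le> measure M1 E"
        using E by (intro measure_mono_fmeasurable) (auto simp: fmeasurable_def)
      have "emeasure \<nu> (((E \<times> space M2) \<inter> W) \<inter> (A n \<times> B n)) \<le> ennreal (2 * (c1 * measure M1 (E \<inter> A n) powr a1))"
        by (rule double[OF KD(4)[OF v, of "E \<inter> A n" n]]) (use E in \<open>auto simp: W_def\<close>)
      also have "\<dots> \<le> ennreal (2 * (c1 * measure M1 E powr a1))"
        using le a1 c by (intro ennreal_leI mult_left_mono powr_mono2) auto
      finally show "emeasure \<nu> (((E \<times> space M2) \<inter> W) \<inter> (A n \<times> B n)) \<le> ennreal (4 * \<Lambda> * \<tau> powr \<theta> * measure M1 E powr a1)"
        by (simp add: c1_def mult_ac)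
    qed (use E in auto)
  next
    fix F assume F: "F \<in> sets M2" "emeasure M2 F < top"
    show "emeasure \<nu> ((space M1 \<times> F) - W) \<le> ennreal (4 * \<Lambda> * \<tau> powr (\<theta> - 1) * measure M2 F powr a2)"
    proof (rule AB_lim)
      fix n
      have le: "measure M2 (F \<inter> B n) \<le> measure M2 F"
        using F by (intro measure_mono_fmeasurable) (auto simp: fmeasurable_def)
      have "emeasure \<nu> (((space M1 \<times> F) - W) \<inter> (A n \<times> B n)) \<le> ennreal (2 * (c2 * measure M2 (F \<inter> B n) powr a2))"
        by (rule double[OF KD(5)[OF v, of "F \<inter> B n" n]])
          (use F sets.sets_into_space[OF F(1)] in \<open>auto simp: W_def space_pair_measure\<close>)
      also have "\<dots> \<le> ennreal (2 * (c2 * measure M2 F powr a2))"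
        using le a2 c by (intro ennreal_leI mult_left_mono powr_mono2) auto
      finally show "emeasure \<nu> (((space M1 \<times> F) - W) \<inter> (A n \<times> B n)) \<le> ennreal (4 * \<Lambda> * \<tau> powr (\<theta> - 1) * measure M2 F powr a2)"
        by (simp add: c2_def mult_ac)
    qed (use F in auto)
  qed
qed

section \<open>Weak \<open>L\<^sub>p\<close> in terms of integrals\<close>

lemma epowr_top [simp]: "epowr top a = top"
  by (simp add: epowr_def)

lemma epowr_ennreal: "0 \<le> x \<Longrightarrow> epowr (ennreal x) a = ennreal (x powr a)"
  by (simp add: epowr_def)

lemma epowr_mono: "0 \<le> a \<Longrightarrow> x \<le> y \<Longrightarrow> epowr x a \<le> epowr y a"
  by (cases x; cases y) (auto simp: epowr_ennreal top_unique intro!: ennreal_leI powr_mono2)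

lemma epowr_inverse: "0 < a \<Longrightarrow> epowr (epowr x a) (1 / a) = x" "0 < a \<Longrightarrow> epowr (epowr x (1 / a)) a = x"
  by (cases x; simp add: epowr_ennreal powr_powr)+

lemma epowr_le_iff: "0 < a \<Longrightarrow> epowr x (1 / a) \<le> y \<longleftrightarrow> x \<le> epowr y a"
  using epowr_mono[of a "epowr x (1 / a)" y] epowr_mono[of "1 / a" x "epowr y a"]
  by (auto simp: epowr_inverse)

lemma less_epowr_iff: "0 < a \<Longrightarrow> y < epowr x (1 / a) \<longleftrightarrow> epowr y a < x"
  using epowr_le_iff[of a x y] by (simp add: not_le[symmetric])

lemma epowr_measurable [measurable (raw)]:
  assumes [measurable]: "f \<in> borel_measurable M"
  shows "(\<lambda>x. epowr (f x) a) \<in> borel_measurable M"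
  unfolding epowr_def by measurable

context sigma_finite_measure
begin

text \<open>Write \<open>h x\<close> as the Lebesgue measure of \<open>{c. 0 < c < h x}\<close> and exchange the integrals.\<close>
lemma layer_cake_weighted:
  assumes [measurable]: "h \<in> borel_measurable M" "w \<in> borel_measurable M"
  shows "(\<integral>\<^sup>+x. w x * h x \<partial>M)
    = (\<integral>\<^sup>+c\<in>{0<..}. (\<integral>\<^sup>+x. w x * indicator {x \<in> space M. ennreal c < h x} x \<partial>M) \<partial>lborel)"
proof -
  interpret L: pair_sigma_finite M lborel ..
  have pt: "y = (\<integral>\<^sup>+c. indicator {c. 0 < c \<and> ennreal c < y} c \<partial>lborel)" for y :: ennreal
  proof (cases y)
    case (real r)
    then have "{c. 0 < c \<and> ennreal c < y} = {0<..<r}"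
      by (auto simp: ennreal_less_iff)
    then show ?thesis using real by simp
  next
    case top
    then have "{c. 0 < c \<and> ennreal c < y} = {0::real<..}" by auto
    moreover have "emeasure lborel {0::real<..} = top"
    proof (rule ccontr)
      assume "emeasure lborel {0::real<..} \<noteq> top"
      then obtain n where "emeasure lborel {0::real<..} < of_nat n"
        using ennreal_Ex_less_of_nat by (auto simp: less_top)
      moreover have "emeasure lborel {0::real<..<real n} \<le> emeasure lborel {0::real<..}"
        by (intro emeasure_mono) auto
      ultimately show False by (simp add: ennreal_of_nat_eq_real_of_nat)
    qed
    ultimately show ?thesis using top by simp
  qed
  let ?P = "{z. 0 < snd z \<and> ennreal (snd z) < h (fst z)}"
  have "(\<integral>\<^sup>+x. w x * h x \<partial>M) = (\<integral>\<^sup>+x. w x * (\<integral>\<^sup>+c. indicator {c. 0 < c \<and> ennreal c < h x} c \<partial>lborel) \<partial>M)"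
    using pt by (intro nn_integral_cong arg_cong2[where f="(*)"] refl)
  also have "\<dots> = (\<integral>\<^sup>+x. (\<integral>\<^sup>+c. w x * indicator {c. 0 < c \<and> ennreal c < h x} c \<partial>lborel) \<partial>M)"
    by (intro nn_integral_cong nn_integral_cmult[symmetric]) measurable
  also have "\<dots> = (\<integral>\<^sup>+x. (\<integral>\<^sup>+c. w x * indicator ?P (x, c) \<partial>lborel) \<partial>M)"
    by (intro nn_integral_cong) (simp add: indicator_def)
  also have "\<dots> = (\<integral>\<^sup>+c. (\<integral>\<^sup>+x. w x * indicator ?P (x, c) \<partial>M) \<partial>lborel)"
    by (intro L.Fubini'[symmetric]) measurable
  also have "\<dots> = (\<integral>\<^sup>+c. (\<integral>\<^sup>+x. indicator {0<..} c * (w x * indicator {x \<in> space M. ennreal c < h x} x) \<partial>M) \<partial>lborel)"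
    by (intro nn_integral_cong) (simp add: indicator_def)
  also have "\<dots> = (\<integral>\<^sup>+c\<in>{0<..}. (\<integral>\<^sup>+x. w x * indicator {x \<in> space M. ennreal c < h x} x \<partial>M) \<partial>lborel)"
    by (intro nn_integral_cong) (simp add: nn_integral_cmult mult.commute)
  finally show ?thesis .
qed

lemma layer_cake:
  assumes [measurable]: "h \<in> borel_measurable M"
  shows "(\<integral>\<^sup>+x. h x \<partial>M) = (\<integral>\<^sup>+c\<in>{0<..}. emeasure M {x \<in> space M. ennreal c < h x} \<partial>lborel)"
  using layer_cake_weighted[of h "\<lambda>_. 1"] by simp

lemma emeasure_le_if_finite_subsets_le:
  assumes X: "X \<in> sets M"
    and le: "\<And>E. E \<in> sets M \<Longrightarrow> E \<subseteq> X \<Longrightarrow> emeasure M E < top \<Longrightarrow> emeasure M E \<le> b"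
  shows "emeasure M X \<le> b"
proof -
  obtain A where A: "range A \<subseteq> sets M" "(\<Union>i. A i) = space M" "\<And>i. emeasure M (A i) \<noteq> \<infinity>" "incseq A"
    using sigma_finite_incseq by blast
  have "X = (\<Union>n. X \<inter> A n)" using A(2) sets.sets_into_space[OF X] by auto
  moreover have "incseq (\<lambda>n. X \<inter> A n)" using A(4) by (auto simp: incseq_def)
  moreover have "range (\<lambda>n. X \<inter> A n) \<subseteq> sets M" using A X by auto
  ultimately have "emeasure M X = (SUP n. emeasure M (X \<inter> A n))"
    using SUP_emeasure_incseq[of "\<lambda>n. X \<inter> A n" M] by simp
  moreover have "emeasure M (X \<inter> A n) \<le> b" for n
  proof (rule le)
    have "emeasure M (X \<inter> A n) \<le> emeasure M (A n)" using A X by (intro emeasure_mono) auto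
    then show "emeasure M (X \<inter> A n) < top" using A(3)[of n] by (simp add: less_top order_le_less_trans)
  qed (use A X in auto)
  ultimately show ?thesis by (auto intro: SUP_least)
qed

text \<open>For \<open>p < \<infinity>\<close> use the layer cake formula for \<open>h\<close> on \<open>E\<close>. A level set \<open>{h > c} \<inter> E\<close> has measure at most \<open>\<mu>(E)\<close> and
  at most \<open>N powr p * c powr (- P)\<close> with \<open>P = p/q > 1\<close>; the first bound is used up to the level \<open>l\<close> at which both
  agree, and the second bound is integrable beyond it.\<close>
lemma weak_Lp_norm_imp_integral_bound:
  assumes h [measurable]: "h \<in> borel_measurable M" and q: "0 < q" "ennreal q < p" and N: "0 < N"
    and weak: "weak_Lp_norm p M (\<lambda>x. epowr (h x) (1 / q)) \<le> ennreal N"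
    and E [measurable]: "E \<in> sets M" and E_fin: "emeasure M E < top"
  shows "(\<integral>\<^sup>+x. h x * indicator E x \<partial>M)
           \<le> ennreal (1 / (1 - q * recip p) * N powr q * measure M E powr (1 - q * recip p))"
proof (cases p)
  case top
  have "AE x in M. epowr (h x) (1 / q) \<le> ennreal N"
    using esssup_AE[where M=M and f="\<lambda>x. epowr (h x) (1 / q)"] weak top
    by (auto simp: weak_Lp_norm_def elim: eventually_mono)
  then have "AE x in M. h x \<le> ennreal (N powr q)"
    using q N by (simp add: epowr_le_iff epowr_ennreal)
  then have "(\<integral>\<^sup>+x. h x * indicator E x \<partial>M) \<le> (\<integral>\<^sup>+x. ennreal (N powr q) * indicator E x \<partial>M)"
    by (intro nn_integral_mono_AE) (auto elim!: eventually_mono intro: mult_right_mono)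
  also have "\<dots> = ennreal (N powr q * measure M E)"
    using E_fin by (simp add: nn_integral_cmult emeasure_eq_ennreal_measure ennreal_mult')
  finally show ?thesis by (simp add: top recip_top)
next
  case (real \<pi>)
  then have \<pi>: "q < \<pi>" "0 < \<pi>" "p = ennreal \<pi>" using q by (auto simp: ennreal_less_iff)
  define P where "P = \<pi> / q"
  have P: "1 < P" using \<pi> q by (simp add: P_def)
  have recip: "q * recip p = 1 / P" using \<pi> q by (simp add: recip_ennreal P_def)
  define e where "e = measure M E"
  have em: "emeasure M E = ennreal e" using E_fin by (simp add: e_def emeasure_eq_ennreal_measure)
  show ?thesis
  proof (cases "e = 0")
    case True
    then have "E \<in> null_sets M" using em by auto
    then show ?thesis by (simp add: nn_integral_null_set)
  next
    case False
    then have e: "0 < e" by (simp add: e_def order_less_le)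
    have tail: "emeasure M {x \<in> space M. ennreal u < h x} \<le> ennreal (N powr \<pi> * u powr (- P))" if u: "0 < u" for u
    proof -
      let ?X = "{x \<in> space M. ennreal u < h x}"
      have "{x \<in> space M. ennreal (u powr (1 / q)) < epowr (h x) (1 / q)} = ?X"
        using q u by (auto simp: less_epowr_iff epowr_ennreal powr_powr)
      moreover have "epowr (ennreal ((u powr (1/q)) powr \<pi>) *
          emeasure M {x \<in> space M. ennreal (u powr (1/q)) < epowr (h x) (1 / q)}) (1 / \<pi>) \<le> ennreal N"
        using weak \<pi> u by (auto simp: weak_Lp_norm_def SUP_le_iff)
      ultimately have "ennreal (u powr P) * emeasure M ?X \<le> ennreal (N powr \<pi>)"
        using \<pi> N u by (simp add: epowr_le_iff epowr_ennreal powr_powr P_def mult.commute)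
      then have "ennreal (u powr (- P)) * (ennreal (u powr P) * emeasure M ?X) \<le> ennreal (u powr (- P)) * ennreal (N powr \<pi>)"
        by (intro mult_left_mono) auto
      moreover have "ennreal (u powr (- P)) * ennreal (u powr P) = 1"
        using u by (simp flip: ennreal_mult powr_add)
      ultimately show ?thesis
        by (simp flip: mult.assoc) (simp add: mult.commute flip: ennreal_mult)
    qed
    define l where "l = N powr q * e powr (- 1 / P)"
    have l: "0 < l" using N e by (simp add: l_def)
    have Nl: "N powr \<pi> * l powr (- P) = e"
    proof -
      have "N powr \<pi> * l powr (- P) = (N powr \<pi> * N powr (- (q * P))) * e powr (P / P)"
        using N e P by (simp add: l_def powr_mult powr_powr mult_ac)
      also have "\<dots> = e" using N e P q by (simp add: P_def flip: powr_add)
      finally show ?thesis .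
    qed
    have "(\<integral>\<^sup>+x. h x * indicator E x \<partial>M)
        = (\<integral>\<^sup>+c\<in>{0<..}. emeasure M {x \<in> space M. ennreal c < h x * indicator E x} \<partial>lborel)"
      by (rule layer_cake) measurable
    also have "\<dots> \<le> (\<integral>\<^sup>+c. ennreal e * indicator {0..l} c + ennreal (N powr \<pi> * c powr (- P)) * indicator {l..} c \<partial>lborel)"
    proof (intro nn_integral_mono)
      fix c :: real
      show "emeasure M {x \<in> space M. ennreal c < h x * indicator E x} * indicator {0<..} c
        \<le> ennreal e * indicator {0..l} c + ennreal (N powr \<pi> * c powr (- P)) * indicator {l..} c"
      proof (cases "0 < c")
        case True
        have "emeasure M {x \<in> space M. ennreal c < h x * indicator E x} \<le> emeasure M E"
          by (intro emeasure_mono) (auto simp: indicator_def split: if_splits)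
        moreover have "emeasure M {x \<in> space M. ennreal c < h x * indicator E x} \<le> emeasure M {x \<in> space M. ennreal c < h x}"
          by (intro emeasure_mono) (auto simp: indicator_def split: if_splits)
        ultimately show ?thesis
          using True tail[OF True] em by (cases "c \<le> l") (auto simp: add_increasing2)
      qed simp
    qed
    also have "\<dots> = (\<integral>\<^sup>+c. ennreal e * indicator {0..l} c \<partial>lborel) + (\<integral>\<^sup>+c. ennreal (N powr \<pi> * c powr (- P)) * indicator {l..} c \<partial>lborel)"
      by (rule nn_integral_add) auto
    also have "(\<integral>\<^sup>+c. ennreal e * indicator {0..l} c \<partial>lborel) = ennreal (e * l)"
      using l e by (simp add: nn_integral_cmult ennreal_mult)
    also have "(\<integral>\<^sup>+c. ennreal (N powr \<pi> * c powr (- P)) * indicator {l..} c \<partial>lborel)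
        = ennreal (0 - (N powr \<pi> * (- 1 / (P - 1))) * l powr (1 - P))"
    proof (rule nn_integral_FTC_atLeast[where F="\<lambda>c. (N powr \<pi> * (- 1 / (P - 1))) * c powr (1 - P)"])
      fix c assume "l \<le> c"
      then have "0 < c" using l by simp
      then have "((\<lambda>c. (N powr \<pi> * (- 1 / (P - 1))) * c powr (1 - P)) has_real_derivative
        (N powr \<pi> * (- 1 / (P - 1))) * ((1 - P) * c powr (1 - P - 1))) (at c)"
        by (intro DERIV_cmult) (auto intro!: derivative_eq_intros)
      moreover have "(N powr \<pi> * (- 1 / (P - 1))) * ((1 - P) * c powr (1 - P - 1)) = N powr \<pi> * c powr (- P)"
        using P by (simp add: field_simps)
      ultimately show "((\<lambda>c. (N powr \<pi> * (- 1 / (P - 1))) * c powr (1 - P)) has_real_derivative N powr \<pi> * c powr (- P)) (at c)"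
        by simp
    next
      have "((\<lambda>c. c powr (1 - P)) \<longlongrightarrow> 0) at_top"
        using P by (intro tendsto_neg_powr filterlim_ident) auto
      then show "((\<lambda>c. (N powr \<pi> * (- 1 / (P - 1))) * c powr (1 - P)) \<longlongrightarrow> 0) at_top"
        by (rule tendsto_mult_right_zero)
    qed auto
    also have "0 - (N powr \<pi> * (- 1 / (P - 1))) * l powr (1 - P) = e * l / (P - 1)"
    proof -
      have "l powr (1 - P) = l powr (- P) * l" using l by (simp add: powr_diff powr_minus_divide)
      then have "N powr \<pi> * l powr (1 - P) = e * l" using Nl by (simp add: mult.assoc[symmetric])
      then show ?thesis by simp
    qed
    also have "ennreal (e * l) + ennreal (e * l / (P - 1)) = ennreal (1 / (1 - 1 / P) * (e * l))"
    proof -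
      have "e * l + e * l / (P - 1) = 1 / (1 - 1 / P) * (e * l)" using P by (simp add: field_simps)
      then show ?thesis using l e P by (simp flip: ennreal_plus)
    qed
    also have "e * l = N powr q * e powr (1 - 1 / P)"
      using e by (simp add: l_def powr_diff powr_minus_divide)
    finally show ?thesis by (simp add: recip e_def mult.assoc)
  qed
qed

text \<open>Chebyshev's inequality on subsets of finite measure of the level sets: if \<open>h > u\<close> on \<open>E\<close>, then
  \<open>u \<mu>(E) \<le> N \<mu>(E) powr (1 - q/p)\<close>, which bounds \<open>\<mu>(E)\<close>.\<close>
lemma integral_bound_imp_weak_Lp_norm:
  assumes h [measurable]: "h \<in> borel_measurable M" and q: "0 < q" "ennreal q < p" and N: "0 \<le> N"
    and bound: "\<And>E. E \<in> sets M \<Longrightarrow> emeasure M E < top \<Longrightarrow>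
       (\<integral>\<^sup>+x. h x * indicator E x \<partial>M) \<le> ennreal (N * measure M E powr (1 - q * recip p))"
  shows "weak_Lp_norm p M (\<lambda>x. epowr (h x) (1 / q)) \<le> ennreal (N powr (1 / q))"
proof -
  have cheb: "u * measure M E \<le> N * measure M E powr (1 - q * recip p)"
    if E: "E \<in> sets M" "emeasure M E < top" "E \<subseteq> {x \<in> space M. ennreal u < h x}" and u: "0 < u" for u E
  proof -
    have "ennreal (u * measure M E) = (\<integral>\<^sup>+x. ennreal u * indicator E x \<partial>M)"
      using E u by (simp add: nn_integral_cmult emeasure_eq_ennreal_measure ennreal_mult')
    also have "\<dots> \<le> (\<integral>\<^sup>+x. h x * indicator E x \<partial>M)"
      using E(3) by (intro nn_integral_mono) (auto simp: indicator_def intro: less_imp_le)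
    also have "\<dots> \<le> ennreal (N * measure M E powr (1 - q * recip p))" using E by (intro bound)
    finally show ?thesis using N by (simp add: ennreal_le_iff)
  qed
  show ?thesis
  proof (cases p)
    case top
    have "AE x in M. h x \<le> ennreal (N + 1 / real (Suc n))" for n
    proof -
      let ?u = "N + 1 / real (Suc n)" 
      let ?X = "{x \<in> space M. ennreal ?u < h x}"
      have "emeasure M ?X \<le> 0"
      proof (rule emeasure_le_if_finite_subsets_le)
        fix E assume E: "E \<in> sets M" "E \<subseteq> ?X" "emeasure M E < top"
        have "?u * measure M E \<le> N * measure M E"
          using cheb[OF E(1,3,2)] N by (simp add: top recip_top add_nonneg_pos)
        then have "1 / real (Suc n) * measure M E \<le> 0" by (simp add: distrib_right)
        then have "measure M E = 0"
          by (metis divide_pos_pos measure_le_0_iff mult_le_0_iff not_le of_nat_0_less_iff zero_less_Suc zero_less_one)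
        then show "emeasure M E \<le> 0" using E by (simp add: emeasure_eq_ennreal_measure)
      qed measurable
      then show ?thesis by (simp add: AE_iff_measurable[of ?X] not_le)
    qed
    then have "AE x in M. \<forall>n. h x \<le> ennreal (N + 1 / real (Suc n))" by (simp add: AE_all_countable)
    then have "AE x in M. epowr (h x) (1 / q) \<le> ennreal (N powr (1 / q))"
    proof eventually_elim
      fix x assume *: "\<forall>n. h x \<le> ennreal (N + 1 / real (Suc n))"
      have "(\<lambda>n. ennreal (N + 1 / real (Suc n))) \<longlonglongrightarrow> ennreal (N + 0)"
        by (intro tendsto_ennrealI tendsto_add tendsto_const LIMSEQ_Suc lim_1_over_n)
      then have "h x \<le> ennreal N" using * by (auto intro: LIMSEQ_le_const)
      then have "epowr (h x) (1 / q) \<le> epowr (ennreal N) (1 / q)" using q by (intro epowr_mono) auto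
      then show "epowr (h x) (1 / q) \<le> ennreal (N powr (1 / q))" using N by (simp add: epowr_ennreal)
    qed
    then show ?thesis by (simp add: top weak_Lp_norm_def esssup_I)
  next
    case (real \<pi>)
    then have \<pi>: "q < \<pi>" "0 < \<pi>" "p = ennreal \<pi>" using q by (auto simp: ennreal_less_iff)
    have recip: "q * recip p = q / \<pi>" using \<pi> q by (simp add: recip_ennreal)
    have "epowr (ennreal (c powr \<pi>) * emeasure M {x \<in> space M. ennreal c < epowr (h x) (1 / q)}) (1 / \<pi>)
        \<le> ennreal (N powr (1 / q))" if c: "0 < c" for c
    proof -
      let ?X = "{x \<in> space M. ennreal c < epowr (h x) (1 / q)}"
      have X: "?X = {x \<in> space M. ennreal (c powr q) < h x}"
        using q c by (auto simp: less_epowr_iff epowr_ennreal)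
      have "emeasure M ?X \<le> ennreal (N powr (\<pi> / q) * c powr (- \<pi>))"
      proof (rule emeasure_le_if_finite_subsets_le)
        fix E assume E: "E \<in> sets M" "E \<subseteq> ?X" "emeasure M E < top"
        let ?e = "measure M E"
        have "?e \<le> N powr (\<pi> / q) * c powr (- \<pi>)"
        proof (cases "?e = 0")
          case False
          then have e: "0 < ?e" by (simp add: order_less_le)
          have "c powr q * ?e \<le> N * ?e powr (1 - q / \<pi>)"
            using cheb[OF E(1,3) E(2)[unfolded X]] c by (simp add: recip)
          then have "c powr q * ?e powr (q / \<pi>) \<le> N"
            using e by (simp add: powr_diff field_simps)
          then have "(c powr q * ?e powr (q / \<pi>)) powr (\<pi> / q) \<le> N powr (\<pi> / q)"
            using \<pi> q by (intro powr_mono2) auto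
          then have "c powr \<pi> * ?e \<le> N powr (\<pi> / q)"
            using c e q \<pi> by (simp add: powr_mult powr_powr)
          then show ?thesis using c by (simp add: powr_minus_divide field_simps)
        qed simp
        then show "emeasure M E \<le> ennreal (N powr (\<pi> / q) * c powr (- \<pi>))"
          using E by (simp add: emeasure_eq_ennreal_measure ennreal_leI)
      qed measurable
      then have "ennreal (c powr \<pi>) * emeasure M ?X \<le> ennreal (c powr \<pi>) * ennreal (N powr (\<pi> / q) * c powr (- \<pi>))"
        by (rule mult_left_mono) simp
      also have "\<dots> = ennreal (N powr (\<pi> / q))"
        using c by (simp add: powr_minus_divide flip: ennreal_mult)
      also have "\<dots> = epowr (ennreal (N powr (1 / q))) \<pi>" by (simp add: epowr_ennreal powr_powr)
      finally show ?thesis using \<pi> by (simp add: epowr_le_iff)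
    qed
    then show ?thesis using \<pi> by (auto simp: weak_Lp_norm_def intro!: SUP_least)
  qed
qed

end

section \<open>The mixed quasi-norms and integrals over rectangles\<close>

lemma abs_add_powr_le:
  fixes a b q :: real
  assumes "0 < q"
  shows "\<bar>a + b\<bar> powr q \<le> 2 powr q * (\<bar>a\<bar> powr q + \<bar>b\<bar> powr q)"
proof -
  have "\<bar>a + b\<bar> powr q \<le> (2 * max \<bar>a\<bar> \<bar>b\<bar>) powr q" using assms by (intro powr_mono2) auto
  also have "\<dots> = 2 powr q * (max \<bar>a\<bar> \<bar>b\<bar>) powr q" by (simp add: powr_mult)
  also have "\<dots> \<le> 2 powr q * (\<bar>a\<bar> powr q + \<bar>b\<bar> powr q)"
    by (intro mult_left_mono) (auto simp: max_def)
  finally show ?thesis .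
qed

lemma recip_bounds:
  assumes "0 < q" "ennreal q < p"
  shows "0 < 1 - q * recip p" "1 - q * recip p \<le> 1"
  using assms by (cases p; simp add: recip_top recip_ennreal ennreal_less_iff)+

lemma rect_sup_leI:
  assumes q: "0 < q" and S: "0 \<le> S"
    and le: "\<And>E F. E \<in> sets M1 \<Longrightarrow> F \<in> sets M2 \<Longrightarrow> 0 < measure M1 E \<Longrightarrow> 0 < measure M2 F \<Longrightarrow>
       emeasure M1 E < top \<Longrightarrow> emeasure M2 F < top \<Longrightarrow>
       (\<integral>\<^sup>+z\<in>E \<times> F. ennreal (\<bar>f z\<bar> powr q) \<partial>(M1 \<Otimes>\<^sub>M M2))
         \<le> ennreal ((S * (measure M1 E powr a * measure M2 F powr b)) powr q)"
  shows "rect_sup q a b M1 M2 f \<le> ennreal S"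
  unfolding rect_sup_def
proof (intro SUP_least, clarify)
  fix E F assume E: "E \<in> sets M1" "0 < emeasure M1 E" "emeasure M1 E < top"
    and F: "F \<in> sets M2" "0 < emeasure M2 F" "emeasure M2 F < top"
  have pos: "0 < measure M1 E" "0 < measure M2 F"
    using E F by (auto simp: measure_def enn2real_positive_iff)
  let ?D = "measure M1 E powr a * measure M2 F powr b"
  have "epowr (\<integral>\<^sup>+z\<in>E \<times> F. ennreal (\<bar>f z\<bar> powr q) \<partial>(M1 \<Otimes>\<^sub>M M2)) (1 / q) \<le> ennreal (S * ?D)"
    using le[OF E(1) F(1) pos E(3) F(3)] q S by (simp add: epowr_le_iff epowr_ennreal)
  then show "epowr (\<integral>\<^sup>+z\<in>E \<times> F. ennreal (\<bar>f z\<bar> powr q) \<partial>(M1 \<Otimes>\<^sub>M M2)) (1 / q) / ennreal ?D \<le> ennreal S"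
    using pos S ennreal_mult'[of S ?D]
    by (intro divide_le_posI_ennreal) (simp_all add: mult.commute)
qed

context pair_sigma_finite
begin

lemma rect_sup_leD:
  assumes q: "0 < q" and S: "0 \<le> S" and le: "rect_sup q a b M1 M2 f \<le> ennreal S"
    and E: "E \<in> sets M1" "emeasure M1 E < top" and F: "F \<in> sets M2" "emeasure M2 F < top"
  shows "(\<integral>\<^sup>+z\<in>E \<times> F. ennreal (\<bar>f z\<bar> powr q) \<partial>(M1 \<Otimes>\<^sub>M M2))
         \<le> ennreal ((S * (measure M1 E powr a * measure M2 F powr b)) powr q)" (is "?I \<le> _")
proof (cases "emeasure M1 E = 0 \<or> emeasure M2 F = 0")
  case True
  then have "E \<times> F \<in> null_sets (M1 \<Otimes>\<^sub>M M2)"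
    using E F by (auto simp: null_sets_def M2.emeasure_pair_measure_Times)
  then show ?thesis by (simp add: nn_integral_null_set)
next
  case False
  then have pos: "0 < emeasure M1 E" "0 < emeasure M2 F" by (auto simp: zero_less_iff_neq_zero)
  then have pos': "0 < measure M1 E" "0 < measure M2 F"
    using E F by (auto simp: measure_def enn2real_positive_iff)
  let ?D = "measure M1 E powr a * measure M2 F powr b"
  have D: "0 < ?D" using pos' by simp
  have "epowr ?I (1 / q) / ennreal ?D \<le> ennreal S"
    using le E F pos unfolding rect_sup_def by (auto simp: SUP_le_iff)
  then have "epowr ?I (1 / q) / ennreal ?D * ennreal ?D \<le> ennreal S * ennreal ?D"
    by (rule mult_right_mono) simp
  moreover have "epowr ?I (1 / q) / ennreal ?D * ennreal ?D = epowr ?I (1 / q)"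
    using ennreal_divide_self[of "ennreal ?D"] D
    by (simp only: ennreal_divide_times) (simp add: ennreal_eq_0_iff not_le)
  ultimately have "epowr ?I (1 / q) \<le> ennreal (S * ?D)"
    using S D by (simp add: ennreal_mult)
  then show ?thesis using q S D by (simp add: epowr_le_iff epowr_ennreal)
qed

lemma nn_integral_rectangle_row:
  assumes [measurable]: "h \<in> borel_measurable (M1 \<Otimes>\<^sub>M M2)" "E \<in> sets M1" "F \<in> sets M2"
  shows "(\<integral>\<^sup>+z\<in>E \<times> F. h z \<partial>(M1 \<Otimes>\<^sub>M M2)) = (\<integral>\<^sup>+x\<in>E. (\<integral>\<^sup>+y\<in>F. h (x, y) \<partial>M2) \<partial>M1)"
proof -
  have "(\<integral>\<^sup>+z\<in>E \<times> F. h z \<partial>(M1 \<Otimes>\<^sub>M M2)) = (\<integral>\<^sup>+x. (\<integral>\<^sup>+y. h (x, y) * indicator (E \<times> F) (x, y) \<partial>M2) \<partial>M1)"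
    by (rule M2.nn_integral_fst[symmetric]) measurable
  also have "\<dots> = (\<integral>\<^sup>+x. (\<integral>\<^sup>+y. (h (x, y) * indicator F y) * indicator E x \<partial>M2) \<partial>M1)"
    by (intro nn_integral_cong) (simp add: indicator_def)
  also have "\<dots> = (\<integral>\<^sup>+x\<in>E. (\<integral>\<^sup>+y\<in>F. h (x, y) \<partial>M2) \<partial>M1)"
    by (intro nn_integral_cong nn_integral_multc) measurable
  finally show ?thesis .
qed

lemma nn_integral_rectangle_column:
  assumes [measurable]: "h \<in> borel_measurable (M1 \<Otimes>\<^sub>M M2)" "E \<in> sets M1" "F \<in> sets M2"
  shows "(\<integral>\<^sup>+z\<in>E \<times> F. h z \<partial>(M1 \<Otimes>\<^sub>M M2)) = (\<integral>\<^sup>+y\<in>F. (\<integral>\<^sup>+x\<in>E. h (x, y) \<partial>M1) \<partial>M2)"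
proof -
  have "(\<integral>\<^sup>+z\<in>E \<times> F. h z \<partial>(M1 \<Otimes>\<^sub>M M2)) = (\<integral>\<^sup>+y. (\<integral>\<^sup>+x. h (x, y) * indicator (E \<times> F) (x, y) \<partial>M1) \<partial>M2)"
    by (rule nn_integral_snd[symmetric]) measurable
  also have "\<dots> = (\<integral>\<^sup>+y. (\<integral>\<^sup>+x. (h (x, y) * indicator E x) * indicator F y \<partial>M1) \<partial>M2)"
    by (intro nn_integral_cong) (simp add: indicator_def)
  also have "\<dots> = (\<integral>\<^sup>+y\<in>F. (\<integral>\<^sup>+x\<in>E. h (x, y) \<partial>M1) \<partial>M2)"
    by (intro nn_integral_cong nn_integral_multc) measurable
  finally show ?thesis .
qed

lemma mixed_norm1_le_imp_integral_bound:
  assumes [measurable]: "g \<in> borel_measurable (M1 \<Otimes>\<^sub>M M2)" and q: "0 < q" "ennreal q < p" and N: "0 < N"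
    and le: "mixed_norm1 p q M1 M2 g \<le> ennreal N"
    and [measurable]: "E \<in> sets M1" "F \<in> sets M2" and fin: "emeasure M1 E < top"
  shows "(\<integral>\<^sup>+z\<in>E \<times> F. ennreal (\<bar>g z\<bar> powr q) \<partial>(M1 \<Otimes>\<^sub>M M2))
    \<le> ennreal (1 / (1 - q * recip p) * N powr q * measure M1 E powr (1 - q * recip p))"
proof -
  have "(\<integral>\<^sup>+z\<in>E \<times> F. ennreal (\<bar>g z\<bar> powr q) \<partial>(M1 \<Otimes>\<^sub>M M2))
      \<le> (\<integral>\<^sup>+x\<in>E. (\<integral>\<^sup>+y. ennreal (\<bar>g (x, y)\<bar> powr q) \<partial>M2) \<partial>M1)"
    by (subst nn_integral_rectangle_row) (auto intro!: nn_integral_mono mult_right_mono simp: indicator_def)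
  also have "\<dots> \<le> ennreal (1 / (1 - q * recip p) * N powr q * measure M1 E powr (1 - q * recip p))"
    using le q N fin by (intro M1.weak_Lp_norm_imp_integral_bound) (auto simp: mixed_norm1_def Lq_norm_def)
  finally show ?thesis .
qed

lemma mixed_norm2_le_imp_integral_bound:
  assumes [measurable]: "g \<in> borel_measurable (M1 \<Otimes>\<^sub>M M2)" and q: "0 < q" "ennreal q < p" and N: "0 < N"
    and le: "mixed_norm2 p q M1 M2 g \<le> ennreal N"
    and [measurable]: "E \<in> sets M1" "F \<in> sets M2" and fin: "emeasure M2 F < top"
  shows "(\<integral>\<^sup>+z\<in>E \<times> F. ennreal (\<bar>g z\<bar> powr q) \<partial>(M1 \<Otimes>\<^sub>M M2))
    \<le> ennreal (1 / (1 - q * recip p) * N powr q * measure M2 F powr (1 - q * recip p))"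
proof -
  have "(\<integral>\<^sup>+z\<in>E \<times> F. ennreal (\<bar>g z\<bar> powr q) \<partial>(M1 \<Otimes>\<^sub>M M2))
      \<le> (\<integral>\<^sup>+y\<in>F. (\<integral>\<^sup>+x. ennreal (\<bar>g (x, y)\<bar> powr q) \<partial>M1) \<partial>M2)"
    by (subst nn_integral_rectangle_column) (auto intro!: nn_integral_mono mult_right_mono simp: indicator_def)
  also have "\<dots> \<le> ennreal (1 / (1 - q * recip p) * N powr q * measure M2 F powr (1 - q * recip p))"
    using le q N fin by (intro M2.weak_Lp_norm_imp_integral_bound) (auto simp: mixed_norm2_def Lq_norm_def)
  finally show ?thesis .
qed

lemma integral_bound_imp_mixed_norm1:
  assumes [measurable]: "g \<in> borel_measurable (M1 \<Otimes>\<^sub>M M2)" and q: "0 < q" "ennreal q < p" and N: "0 \<le> N"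
    and bound: "\<And>E. E \<in> sets M1 \<Longrightarrow> emeasure M1 E < top \<Longrightarrow>
      (\<integral>\<^sup>+z\<in>E \<times> space M2. ennreal (\<bar>g z\<bar> powr q) \<partial>(M1 \<Otimes>\<^sub>M M2)) \<le> ennreal (N * measure M1 E powr (1 - q * recip p))"
  shows "g \<in> mixed_space1 p q M1 M2" "mixed_norm1 p q M1 M2 g \<le> ennreal (N powr (1 / q))"
proof -
  have row: "(\<integral>\<^sup>+z\<in>E \<times> space M2. ennreal (\<bar>g z\<bar> powr q) \<partial>(M1 \<Otimes>\<^sub>M M2)) = (\<integral>\<^sup>+x\<in>E. (\<integral>\<^sup>+y. ennreal (\<bar>g (x, y)\<bar> powr q) \<partial>M2) \<partial>M1)"
    if [measurable]: "E \<in> sets M1" for E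
    by (subst nn_integral_rectangle_row) (auto intro!: nn_integral_cong)
  show le: "mixed_norm1 p q M1 M2 g \<le> ennreal (N powr (1 / q))"
    unfolding mixed_norm1_def Lq_norm_def
    by (rule M1.integral_bound_imp_weak_Lp_norm[OF _ q N]) (use bound row in auto)
  have "mixed_norm1 p q M1 M2 g < top" using le by (rule order_le_less_trans) simp
  then show "g \<in> mixed_space1 p q M1 M2"
    by (auto simp: mixed_space1_def weak_Lp_def mixed_norm1_def Lq_norm_def)
qed

lemma integral_bound_imp_mixed_norm2:
  assumes [measurable]: "g \<in> borel_measurable (M1 \<Otimes>\<^sub>M M2)" and q: "0 < q" "ennreal q < p" and N: "0 \<le> N"
    and bound: "\<And>F. F \<in> sets M2 \<Longrightarrow> emeasure M2 F < top \<Longrightarrow>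
      (\<integral>\<^sup>+z\<in>space M1 \<times> F. ennreal (\<bar>g z\<bar> powr q) \<partial>(M1 \<Otimes>\<^sub>M M2)) \<le> ennreal (N * measure M2 F powr (1 - q * recip p))"
  shows "g \<in> mixed_space2 p q M1 M2" "mixed_norm2 p q M1 M2 g \<le> ennreal (N powr (1 / q))"
proof -
  have column: "(\<integral>\<^sup>+z\<in>space M1 \<times> F. ennreal (\<bar>g z\<bar> powr q) \<partial>(M1 \<Otimes>\<^sub>M M2)) = (\<integral>\<^sup>+y\<in>F. (\<integral>\<^sup>+x. ennreal (\<bar>g (x, y)\<bar> powr q) \<partial>M1) \<partial>M2)"
    if [measurable]: "F \<in> sets M2" for F
    by (subst nn_integral_rectangle_column) (auto intro!: nn_integral_cong)
  show le: "mixed_norm2 p q M1 M2 g \<le> ennreal (N powr (1 / q))"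
    unfolding mixed_norm2_def Lq_norm_def
    by (rule M2.integral_bound_imp_weak_Lp_norm[OF _ q N]) (use bound column in auto)
  have "mixed_norm2 p q M1 M2 g < top" using le by (rule order_le_less_trans) simp
  then show "g \<in> mixed_space2 p q M1 M2"
    by (auto simp: mixed_space2_def weak_Lp_def mixed_norm2_def Lq_norm_def)
qed

end

section \<open>Equivalence of the interpolation quasi-norm and the rectangle supremum\<close>

lemma lower_constant_pos:
  assumes "0 < q" "ennreal q < p1" "ennreal q < p2"
  shows "0 < 2 * (1 / (1 - q * recip p1) + 1 / (1 - q * recip p2)) powr (1 / q)"
proof -
  have "0 < 1 - q * recip p1" "0 < 1 - q * recip p2" using recip_bounds assms by blast+
  then have "0 < 1 / (1 - q * recip p1) + 1 / (1 - q * recip p2)"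
    by (intro add_pos_pos divide_pos_pos) auto
  then show ?thesis by (metis less_irrefl mult_pos_pos powr_gt_zero zero_less_numeral)
qed

context pair_sigma_finite
begin

text \<open>The exponents match for the parameter \<open>\<tau> = t\<^sup>q\<close> in the decomposition of the product: both terms of the
  K-functional are then of size \<open>t powr \<theta>\<close>.\<close>
lemma K_functional_le_rect_sup:
  assumes f [measurable]: "f \<in> borel_measurable (M1 \<Otimes>\<^sub>M M2)"
    and q: "0 < q" "ennreal q < p1" "ennreal q < p2" and \<theta>: "0 < \<theta>" "\<theta> < 1"
    and S: "0 < S" and t: "0 < t"
    and le: "rect_sup q ((1 - \<theta>) * (1 / q - recip p1)) (\<theta> * (1 / q - recip p2)) M1 M2 f \<le> ennreal S"
  shows "K_functional (M1 \<Otimes>\<^sub>M M2) (mixed_space1 p1 q M1 M2) (mixed_norm1 p1 q M1 M2)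
      (mixed_space2 p2 q M1 M2) (mixed_norm2 p2 q M1 M2) t f \<le> ennreal (2 * 4 powr (1 / q) * S * t powr \<theta>)"
proof -
  define a1 where "a1 = 1 - q * recip p1"
  define a2 where "a2 = 1 - q * recip p2"
  have a: "0 < a1" "a1 \<le> 1" "0 < a2" "a2 \<le> 1"
    using recip_bounds q unfolding a1_def a2_def by blast+
  have qa: "(1 / q - recip p1) * q = a1" "(1 / q - recip p2) * q = a2"
    using q by (simp_all add: a1_def a2_def field_simps)
  define g where "g z = ennreal (\<bar>f z\<bar> powr q)" for z
  have g [measurable]: "g \<in> borel_measurable (M1 \<Otimes>\<^sub>M M2)" unfolding g_def by measurable
  have em: "emeasure (density (M1 \<Otimes>\<^sub>M M2) g) X = (\<integral>\<^sup>+z\<in>X. g z \<partial>(M1 \<Otimes>\<^sub>M M2))"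
    if "X \<in> sets (M1 \<Otimes>\<^sub>M M2)" for X
    using that by (simp add: emeasure_density)
  obtain W where W [measurable]: "W \<in> sets (M1 \<Otimes>\<^sub>M M2)"
    and W1: "\<And>E. E \<in> sets M1 \<Longrightarrow> emeasure M1 E < top \<Longrightarrow>
       emeasure (density (M1 \<Otimes>\<^sub>M M2) g) ((E \<times> space M2) \<inter> W)
         \<le> ennreal (4 * S powr q * (t powr q) powr \<theta> * measure M1 E powr a1)"
    and W2: "\<And>F. F \<in> sets M2 \<Longrightarrow> emeasure M2 F < top \<Longrightarrow>
       emeasure (density (M1 \<Otimes>\<^sub>M M2) g) ((space M1 \<times> F) - W)
         \<le> ennreal (4 * S powr q * (t powr q) powr (\<theta> - 1) * measure M2 F powr a2)"
  proof (rule product_decomposition[OF g \<theta> a(1,2) a(3,4), of "S powr q" "t powr q"])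
    fix E F assume EF: "E \<in> sets M1" "F \<in> sets M2" "emeasure M1 E < top" "emeasure M2 F < top"
    then have "emeasure (density (M1 \<Otimes>\<^sub>M M2) g) (E \<times> F) = (\<integral>\<^sup>+z\<in>E \<times> F. ennreal (\<bar>f z\<bar> powr q) \<partial>(M1 \<Otimes>\<^sub>M M2))"
      by (subst em) (auto simp: g_def)
    also have "\<dots> \<le> ennreal ((S * (measure M1 E powr ((1 - \<theta>) * (1 / q - recip p1))
          * measure M2 F powr (\<theta> * (1 / q - recip p2)))) powr q)"
      using EF q S le by (intro rect_sup_leD) auto
    also have "\<dots> = ennreal (S powr q * measure M1 E powr ((1 - \<theta>) * a1) * measure M2 F powr (\<theta> * a2))"
      using S by (simp add: powr_mult powr_powr qa mult.assoc)
    finally show "emeasure (density (M1 \<Otimes>\<^sub>M M2) g) (E \<times> F)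
      \<le> ennreal (S powr q * measure M1 E powr ((1 - \<theta>) * a1) * measure M2 F powr (\<theta> * a2))" .
  qed (use S t in auto)
  define f1 where "f1 z = f z * indicator W z" for z
  define f2 where "f2 z = f z * (1 - indicator W z)" for z
  have f1_meas [measurable]: "f1 \<in> borel_measurable (M1 \<Otimes>\<^sub>M M2)" unfolding f1_def by measurable
  have f2_meas [measurable]: "f2 \<in> borel_measurable (M1 \<Otimes>\<^sub>M M2)" unfolding f2_def by measurable
  have bound1: "(\<integral>\<^sup>+z\<in>E \<times> space M2. ennreal (\<bar>f1 z\<bar> powr q) \<partial>(M1 \<Otimes>\<^sub>M M2))
        \<le> ennreal (4 * S powr q * (t powr q) powr \<theta> * measure M1 E powr (1 - q * recip p1))"
    if E: "E \<in> sets M1" "emeasure M1 E < top" for E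
  proof -
    have "(\<integral>\<^sup>+z\<in>E \<times> space M2. ennreal (\<bar>f1 z\<bar> powr q) \<partial>(M1 \<Otimes>\<^sub>M M2))
        = emeasure (density (M1 \<Otimes>\<^sub>M M2) g) ((E \<times> space M2) \<inter> W)"
      using E by (subst em) (auto intro!: nn_integral_cong simp: f1_def g_def indicator_def)
    then show ?thesis using W1[OF E] by (simp add: a1_def)
  qed
  have bound2: "(\<integral>\<^sup>+z\<in>space M1 \<times> F. ennreal (\<bar>f2 z\<bar> powr q) \<partial>(M1 \<Otimes>\<^sub>M M2))
        \<le> ennreal (4 * S powr q * (t powr q) powr (\<theta> - 1) * measure M2 F powr (1 - q * recip p2))"
    if F: "F \<in> sets M2" "emeasure M2 F < top" for F
  proof -
    have "(\<integral>\<^sup>+z\<in>space M1 \<times> F. ennreal (\<bar>f2 z\<bar> powr q) \<partial>(M1 \<Otimes>\<^sub>M M2))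
        = emeasure (density (M1 \<Otimes>\<^sub>M M2) g) ((space M1 \<times> F) - W)"
      using F by (subst em) (auto intro!: nn_integral_cong simp: f2_def g_def indicator_def)
    then show ?thesis using W2[OF F] by (simp add: a2_def)
  qed
  note f1 = integral_bound_imp_mixed_norm1[OF f1_meas q(1,2) _ bound1, simplified]
  note f2 = integral_bound_imp_mixed_norm2[OF f2_meas q(1,3) _ bound2, simplified]
  have root: "(4 * S powr q * (t powr q) powr b) powr (1 / q) = 4 powr (1 / q) * S * t powr b" for b
    using q S t by (simp add: powr_mult powr_powr)
  have "f z = f1 z + f2 z" for z by (simp add: f1_def f2_def indicator_def)
  then have "(f1, f2) \<in> decompositions (M1 \<Otimes>\<^sub>M M2) (mixed_space1 p1 q M1 M2) (mixed_space2 p2 q M1 M2) f"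
    using f1 f2 by (auto simp: decompositions_def)
  then have "K_functional (M1 \<Otimes>\<^sub>M M2) (mixed_space1 p1 q M1 M2) (mixed_norm1 p1 q M1 M2)
      (mixed_space2 p2 q M1 M2) (mixed_norm2 p2 q M1 M2) t f
      \<le> mixed_norm1 p1 q M1 M2 f1 + ennreal t * mixed_norm2 p2 q M1 M2 f2"
    unfolding K_functional_def by (rule INF_lower2) simp
  also have "\<dots> \<le> ennreal (4 powr (1 / q) * S * t powr \<theta>) + ennreal t * ennreal (4 powr (1 / q) * S * t powr (\<theta> - 1))"
    using f1(2) f2(2) unfolding root by (intro add_mono mult_left_mono) auto
  also have "\<dots> = ennreal (2 * 4 powr (1 / q) * S * t powr \<theta>)"
  proof -
    have "t * t powr (\<theta> - 1) = t powr \<theta>" using t by (simp add: powr_mult_base)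
    then have "t * (4 powr (1 / q) * S * t powr (\<theta> - 1)) = 4 powr (1 / q) * S * t powr \<theta>"
      by (metis mult.assoc mult.left_commute)
    then show ?thesis using S t by (simp flip: ennreal_mult ennreal_plus)
  qed
  finally show ?thesis .
qed

text \<open>A decomposition exists for every \<open>S\<close> above the supremum; letting \<open>S\<close> decrease to it also covers the
  case where the supremum is \<open>0\<close>.\<close>
lemma interp_norm_le_rect_sup:
  assumes f: "f \<in> borel_measurable (M1 \<Otimes>\<^sub>M M2)"
    and q: "0 < q" "ennreal q < p1" "ennreal q < p2" and \<theta>: "0 < \<theta>" "\<theta> < 1"
  shows "mixed_interp_norm q p1 p2 \<theta> M1 M2 f \<le> ennreal (2 * 4 powr (1 / q)) *
     rect_sup q ((1 - \<theta>) * (1 / q - recip p1)) (\<theta> * (1 / q - recip p2)) M1 M2 f" (is "?N \<le> ennreal ?C * ?R")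
proof (cases "?R")
  case top
  then show ?thesis by (simp add: ennreal_mult_top)
next
  case (real r)
  have C: "0 < ?C" by simp
  have le: "?N \<le> ennreal (?C * S)" if S: "r < S" for S
  proof -
    have "0 < S" using real S by simp
    have "ennreal (t powr (- \<theta>)) * K_functional (M1 \<Otimes>\<^sub>M M2) (mixed_space1 p1 q M1 M2) (mixed_norm1 p1 q M1 M2)
      (mixed_space2 p2 q M1 M2) (mixed_norm2 p2 q M1 M2) t f \<le> ennreal (?C * S)" if t: "0 < t" for t
    proof -
      have "ennreal (t powr (- \<theta>)) * K_functional (M1 \<Otimes>\<^sub>M M2) (mixed_space1 p1 q M1 M2) (mixed_norm1 p1 q M1 M2)
          (mixed_space2 p2 q M1 M2) (mixed_norm2 p2 q M1 M2) t f
        \<le> ennreal (t powr (- \<theta>)) * ennreal (?C * S * t powr \<theta>)"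
        using K_functional_le_rect_sup[OF f q \<theta> \<open>0 < S\<close> t] real S
        by (intro mult_left_mono) (auto simp: ennreal_leI)
      also have "\<dots> = ennreal (?C * S)"
        using t \<open>0 < S\<close> by (simp add: powr_minus_divide flip: ennreal_mult)
      finally show ?thesis .
    qed
    then show ?thesis by (auto simp: mixed_interp_norm_def interp_norm_def intro!: SUP_least)
  qed
  have "?N \<le> ennreal (?C * r)"
  proof (rule ennreal_le_epsilon)
    fix e :: real assume e: "0 < e"
    have "?N \<le> ennreal (?C * (r + e / ?C))" using e by (intro le) simp
    also have "?C * (r + e / ?C) = ?C * r + e" using C by (simp add: distrib_left)
    finally show "?N \<le> ennreal (?C * r) + ennreal e" using real e by (simp add: ennreal_plus)
  qed
  then show ?thesis using real by (simp add: ennreal_mult)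
qed

text \<open>For given \<open>E\<close> and \<open>F\<close> take \<open>t = \<mu>\<^sub>2(F) powr \<alpha>2 / \<mu>\<^sub>1(E) powr \<alpha>1\<close>, for which the bounds on the integrals of
  \<open>\<bar>f\<^sub>1\<bar>\<^sup>q\<close> and \<open>\<bar>f\<^sub>2\<bar>\<^sup>q\<close> over \<open>E \<times> F\<close> coincide up to constants.\<close>
lemma rect_sup_le_interp_norm:
  assumes f [measurable]: "f \<in> borel_measurable (M1 \<Otimes>\<^sub>M M2)"
    and q: "0 < q" "ennreal q < p1" "ennreal q < p2" and \<theta>: "0 < \<theta>" "\<theta> < 1"
  defines "C \<equiv> 2 * (1 / (1 - q * recip p1) + 1 / (1 - q * recip p2)) powr (1 / q)"
  shows "rect_sup q ((1 - \<theta>) * (1 / q - recip p1)) (\<theta> * (1 / q - recip p2)) M1 M2 f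
     \<le> ennreal C * mixed_interp_norm q p1 p2 \<theta> M1 M2 f" (is "?R \<le> _ * ?N")
proof (cases "?N")
  define \<alpha>1 where "\<alpha>1 = 1 / q - recip p1"
  define \<alpha>2 where "\<alpha>2 = 1 / q - recip p2"
  define a1 where "a1 = 1 - q * recip p1"
  define a2 where "a2 = 1 - q * recip p2"
  define K where "K t = K_functional (M1 \<Otimes>\<^sub>M M2) (mixed_space1 p1 q M1 M2) (mixed_norm1 p1 q M1 M2)
      (mixed_space2 p2 q M1 M2) (mixed_norm2 p2 q M1 M2) t f" for t
  have a: "0 < a1" "0 < a2"
    using recip_bounds q unfolding a1_def a2_def by blast+
  have qa: "\<alpha>1 * q = a1" "\<alpha>2 * q = a2"
    using q by (simp_all add: \<alpha>1_def \<alpha>2_def a1_def a2_def field_simps)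
  define A where "A = 1 / a1 + 1 / a2"
  have A: "0 < A" using a by (simp add: A_def add_pos_pos)
  have C: "C = 2 * A powr (1 / q)" "0 < C" using A by (auto simp: C_def A_def a1_def a2_def)
  case (real r)
  have le: "?R \<le> ennreal (C * N)" if N: "r < N" for N
  proof (rule rect_sup_leI[OF q(1)])
    have N0: "0 < N" using real N by simp
    then show "0 \<le> C * N" using C by simp
    fix E F assume E [measurable]: "E \<in> sets M1" and F [measurable]: "F \<in> sets M2"
      and pos: "0 < measure M1 E" "0 < measure M2 F"
      and fin: "emeasure M1 E < top" "emeasure M2 F < top"
    define e where "e = measure M1 E"
    define d where "d = measure M2 F"
    have ed: "0 < e" "0 < d" using pos by (auto simp: e_def d_def)
    define t where "t = d powr \<alpha>2 / e powr \<alpha>1"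
    have t: "0 < t" using ed by (simp add: t_def)
    define k where "k = N * t powr \<theta>"
    have k: "0 < k" using N0 t by (simp add: k_def)
    have "ennreal (t powr (- \<theta>)) * K t \<le> ?N"
      unfolding mixed_interp_norm_def interp_norm_def K_def using t by (intro SUP_upper) simp
    then have "ennreal (t powr (- \<theta>)) * K t < ennreal N"
      using real N by (auto simp: ennreal_less_iff order_le_less_trans)
    then have "K t < ennreal k"
    proof (rule contrapos_pp)
      assume "\<not> K t < ennreal k"
      then have "ennreal (t powr (- \<theta>)) * ennreal k \<le> ennreal (t powr (- \<theta>)) * K t"
        by (intro mult_left_mono) auto
      moreover have "ennreal (t powr (- \<theta>)) * ennreal k = ennreal N"
        using t N0 by (simp add: k_def powr_minus_divide flip: ennreal_mult)
      ultimately show "\<not> ennreal (t powr (- \<theta>)) * K t < ennreal N" by simp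
    qed
    then obtain f1 f2 where dec: "f1 \<in> mixed_space1 p1 q M1 M2" "f2 \<in> mixed_space2 p2 q M1 M2"
        "AE z in M1 \<Otimes>\<^sub>M M2. f z = f1 z + f2 z"
      and lt: "mixed_norm1 p1 q M1 M2 f1 + ennreal t * mixed_norm2 p2 q M1 M2 f2 < ennreal k"
      unfolding K_def K_functional_def INF_less_iff by (auto simp: decompositions_def)
    have [measurable]: "f1 \<in> borel_measurable (M1 \<Otimes>\<^sub>M M2)" "f2 \<in> borel_measurable (M1 \<Otimes>\<^sub>M M2)"
      using dec by (auto simp: mixed_space1_def mixed_space2_def)
    have n1: "mixed_norm1 p1 q M1 M2 f1 \<le> ennreal k"
      using lt by (meson add_increasing2 le_less_trans less_imp_le not_le zero_le)
    have "ennreal t * mixed_norm2 p2 q M1 M2 f2 \<le> ennreal k"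
      using lt by (meson add_increasing le_less_trans less_imp_le not_le zero_le)
    then have "ennreal (1 / t) * (ennreal t * mixed_norm2 p2 q M1 M2 f2) \<le> ennreal (1 / t) * ennreal k"
      by (rule mult_left_mono) simp
    moreover have "ennreal (1 / t) * ennreal t = 1" using t by (simp flip: ennreal_mult)
    ultimately have n2: "mixed_norm2 p2 q M1 M2 f2 \<le> ennreal (k / t)"
      using t k by (simp flip: mult.assoc) (simp flip: ennreal_mult)
    have "(\<integral>\<^sup>+z\<in>E \<times> F. ennreal (\<bar>f z\<bar> powr q) \<partial>(M1 \<Otimes>\<^sub>M M2))
      \<le> (\<integral>\<^sup>+z. ennreal (2 powr q) * (ennreal (\<bar>f1 z\<bar> powr q) * indicator (E \<times> F) z
            + ennreal (\<bar>f2 z\<bar> powr q) * indicator (E \<times> F) z) \<partial>(M1 \<Otimes>\<^sub>M M2))"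
    proof (rule nn_integral_mono_AE)
      show "AE z in M1 \<Otimes>\<^sub>M M2. ennreal (\<bar>f z\<bar> powr q) * indicator (E \<times> F) z \<le> ennreal (2 powr q)
        * (ennreal (\<bar>f1 z\<bar> powr q) * indicator (E \<times> F) z + ennreal (\<bar>f2 z\<bar> powr q) * indicator (E \<times> F) z)"
        using dec(3)
      proof eventually_elim
        fix z assume "f z = f1 z + f2 z"
        then have "ennreal (\<bar>f z\<bar> powr q) \<le> ennreal (2 powr q * (\<bar>f1 z\<bar> powr q + \<bar>f2 z\<bar> powr q))"
          using abs_add_powr_le[OF q(1)] by (intro ennreal_leI) simp
        then show "ennreal (\<bar>f z\<bar> powr q) * indicator (E \<times> F) z \<le> ennreal (2 powr q)
          * (ennreal (\<bar>f1 z\<bar> powr q) * indicator (E \<times> F) z + ennreal (\<bar>f2 z\<bar> powr q) * indicator (E \<times> F) z)"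
          by (auto simp: indicator_def ennreal_mult)
      qed
    qed
    also have "\<dots> = ennreal (2 powr q) * ((\<integral>\<^sup>+z\<in>E \<times> F. ennreal (\<bar>f1 z\<bar> powr q) \<partial>(M1 \<Otimes>\<^sub>M M2))
        + (\<integral>\<^sup>+z\<in>E \<times> F. ennreal (\<bar>f2 z\<bar> powr q) \<partial>(M1 \<Otimes>\<^sub>M M2)))"
      by (simp add: nn_integral_cmult nn_integral_add)
    also have "\<dots> \<le> ennreal (2 powr q) * (ennreal (1 / a1 * k powr q * e powr a1) + ennreal (1 / a2 * (k / t) powr q * d powr a2))"
      unfolding a1_def a2_def e_def d_def using q k t n1 n2 fin
      by (intro mult_left_mono add_mono mixed_norm1_le_imp_integral_bound mixed_norm2_le_imp_integral_bound) auto
    also have "\<dots> = ennreal (2 powr q * (A * (k powr q * e powr a1)))"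
    proof -
      have "(k / t) powr q * d powr a2 = k powr q * e powr a1"
        using ed k by (simp add: t_def powr_divide powr_mult powr_powr qa)
      then have "1 / a1 * k powr q * e powr a1 + 1 / a2 * (k / t) powr q * d powr a2 = A * (k powr q * e powr a1)"
        by (simp add: A_def distrib_right)
      then show ?thesis using a A by (simp flip: ennreal_mult ennreal_plus)
    qed
    also have "2 powr q * (A * (k powr q * e powr a1))
        = (C * N * (e powr ((1 - \<theta>) * \<alpha>1) * d powr (\<theta> * \<alpha>2))) powr q"
    proof -
      have "k * e powr \<alpha>1 = N * (e powr ((1 - \<theta>) * \<alpha>1) * d powr (\<theta> * \<alpha>2))"
      proof -
        have "t powr \<theta> * e powr \<alpha>1 = d powr (\<theta> * \<alpha>2) * (e powr (- (\<theta> * \<alpha>1)) * e powr \<alpha>1)"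
          using ed by (simp add: t_def powr_divide powr_powr powr_minus_divide mult.commute)
        also have "e powr (- (\<theta> * \<alpha>1)) * e powr \<alpha>1 = e powr ((1 - \<theta>) * \<alpha>1)"
          by (simp add: algebra_simps flip: powr_add)
        finally show ?thesis by (simp add: k_def mult_ac)
      qed
      then have "C * N * (e powr ((1 - \<theta>) * \<alpha>1) * d powr (\<theta> * \<alpha>2)) = 2 * (A powr (1 / q) * (k * e powr \<alpha>1))"
        by (simp add: C(1) mult_ac)
      moreover have "(2 * (A powr (1 / q) * (k * e powr \<alpha>1))) powr q = 2 powr q * (A * (k powr q * e powr a1))"
        using A k ed q by (simp add: powr_mult powr_powr qa)
      ultimately show ?thesis by simp
    qed
    finally show "(\<integral>\<^sup>+z\<in>E \<times> F. ennreal (\<bar>f z\<bar> powr q) \<partial>(M1 \<Otimes>\<^sub>M M2))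
      \<le> ennreal ((C * N * (measure M1 E powr ((1 - \<theta>) * (1 / q - recip p1)) * measure M2 F powr (\<theta> * (1 / q - recip p2)))) powr q)"
      by (simp add: e_def d_def \<alpha>1_def \<alpha>2_def)
  qed
  have "?R \<le> ennreal (C * r)"
  proof (rule ennreal_le_epsilon)
    fix x :: real assume x: "0 < x"
    have "?R \<le> ennreal (C * (r + x / C))" using x C by (intro le) simp
    also have "C * (r + x / C) = C * r + x" using C by (simp add: distrib_left)
    finally show "?R \<le> ennreal (C * r) + ennreal x" using real x C by (simp add: ennreal_plus)
  qed
  then show ?thesis using real C by (simp add: ennreal_mult)
next
  case top
  have "0 < C" unfolding C_def using q by (rule lower_constant_pos)
  then show ?thesis using top by (simp add: ennreal_mult_top)
qed

end

section \<open>The kernel operator on Lorentz spaces\<close>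

lemma recip_conj_exponent:
  assumes "1 < p"
  shows "recip (conj_exponent p) = 1 - recip p"
proof (cases p)
  case (real r)
  then have "1 < r" using assms by (simp add: ennreal_less_iff flip: ennreal_1)
  then have "1 / p = ennreal (1 / r)" using real by (simp add: divide_ennreal_def inverse_ennreal inverse_eq_divide)
  moreover have "1 - ennreal (1 / r) = ennreal (1 - 1 / r)" using \<open>1 < r\<close> by (simp flip: ennreal_1 add: ennreal_minus)
  ultimately have "conj_exponent p = ennreal (1 / (1 - 1 / r))"
    using \<open>1 < r\<close> by (simp add: conj_exponent_def divide_ennreal_def inverse_ennreal inverse_eq_divide)
  then show ?thesis using \<open>1 < r\<close> real by (simp add: recip_ennreal)
next
  case top
  then show ?thesis using recip_ennreal[of 1] by (simp add: conj_exponent_def recip_top)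
qed

lemma epowr_1 [simp]: "epowr x 1 = x"
  by (cases x) (auto simp: epowr_ennreal)

text \<open>The measure of \<open>{\<bar>g\<bar> > b}\<close> decreases in \<open>b\<close>, so an infinite value at \<open>c\<close> would make the integrand infinite on
  all of \<open>{0<..<c}\<close>.\<close>
lemma Lorentz1_level_set_finite:
  assumes [measurable]: "g \<in> borel_measurable M" and fin: "Lorentz1_norm r M g < top" and c: "0 < c"
  shows "emeasure M {x \<in> space M. c < \<bar>g x\<bar>} < top"
proof (rule ccontr)
  assume "\<not> ?thesis"
  then have top: "emeasure M {x \<in> space M. c < \<bar>g x\<bar>} = top" by (simp only: less_top[symmetric]) simp
  have "(\<integral>\<^sup>+b. top * indicator {0<..<c} b \<partial>lborel) \<le> Lorentz1_norm r M g"
    unfolding Lorentz1_norm_def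
  proof (rule nn_integral_mono)
    fix b
    show "top * indicator {0<..<c} b \<le> epowr (emeasure M {x \<in> space M. b < \<bar>g x\<bar>}) (1 / r) * indicator {0<..} b"
    proof (cases "0 < b \<and> b < c")
      case True
      then have "emeasure M {x \<in> space M. c < \<bar>g x\<bar>} \<le> emeasure M {x \<in> space M. b < \<bar>g x\<bar>}"
        by (intro emeasure_mono) auto
      then show ?thesis using True top by (simp add: top_unique)
    qed (auto simp: indicator_def)
  qed
  moreover have "(\<integral>\<^sup>+b. top * indicator {0<..<c} b \<partial>lborel) = top"
    using c by (subst nn_integral_cmult_indicator) (auto simp: ennreal_top_mult)
  ultimately show False using fin by (simp add: top_unique)
qed

lemma Lorentz1_norm_indicator:
  assumes F [measurable]: "F \<in> sets M" and fin: "emeasure M F < top"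
  shows "Lorentz1_norm r M (indicator F) = ennreal (measure M F powr (1 / r))"
proof -
  have "Lorentz1_norm r M (indicator F) = (\<integral>\<^sup>+c. ennreal (measure M F powr (1 / r)) * indicator {0<..<1::real} c \<partial>lborel)"
    unfolding Lorentz1_norm_def
  proof (intro nn_integral_cong)
    fix c :: real
    have "{x \<in> space M. c < \<bar>indicator F x\<bar>} = (if c < 1 then F else {})" if "0 < c"
      using that sets.sets_into_space[OF F] by (auto simp: indicator_def split: if_splits)
    then show "epowr (emeasure M {x \<in> space M. c < \<bar>indicator F x\<bar>}) (1 / r) * indicator {0<..} c
        = ennreal (measure M F powr (1 / r)) * indicator {0<..<1} c"
      using fin epowr_ennreal[of 0 "1 / r"]
      by (auto simp: indicator_def emeasure_eq_ennreal_measure epowr_ennreal)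
  qed
  then show ?thesis by (simp add: nn_integral_cmult)
qed

context pair_sigma_finite
begin

text \<open>Integrate the bound for \<open>F = {\<bar>g\<bar> > c}\<close> over \<open>c\<close>.\<close>
lemma rectangle_bound_imp_Lorentz_bound:
  assumes f [measurable]: "f \<in> borel_measurable (M1 \<Otimes>\<^sub>M M2)" and g: "g \<in> Lorentz1 r M2"
    and E [measurable]: "E \<in> sets M1" and B: "0 \<le> B"
    and bound: "\<And>F. F \<in> sets M2 \<Longrightarrow> emeasure M2 F < top \<Longrightarrow>
      (\<integral>\<^sup>+z\<in>E \<times> F. ennreal \<bar>f z\<bar> \<partial>(M1 \<Otimes>\<^sub>M M2)) \<le> ennreal (B * measure M2 F powr (1 / r))"
  shows "(\<integral>\<^sup>+x\<in>E. (\<integral>\<^sup>+y. ennreal (\<bar>f (x, y)\<bar> * \<bar>g y\<bar>) \<partial>M2) \<partial>M1) \<le> ennreal B * Lorentz1_norm r M2 g"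
proof -
  have g' [measurable]: "g \<in> borel_measurable M2" and g_fin: "Lorentz1_norm r M2 g < top"
    using g by (auto simp: Lorentz1_def)
  define w where "w y = (\<integral>\<^sup>+x\<in>E. ennreal \<bar>f (x, y)\<bar> \<partial>M1)" for y
  have w [measurable]: "w \<in> borel_measurable M2" unfolding w_def by measurable
  have "(\<integral>\<^sup>+x\<in>E. (\<integral>\<^sup>+y. ennreal (\<bar>f (x, y)\<bar> * \<bar>g y\<bar>) \<partial>M2) \<partial>M1)
      = (\<integral>\<^sup>+z\<in>E \<times> space M2. ennreal (\<bar>f z\<bar> * \<bar>g (snd z)\<bar>) \<partial>(M1 \<Otimes>\<^sub>M M2))"
    by (subst nn_integral_rectangle_row) (auto intro!: nn_integral_cong)
  also have "\<dots> = (\<integral>\<^sup>+y\<in>space M2. (\<integral>\<^sup>+x\<in>E. ennreal (\<bar>f (x, y)\<bar> * \<bar>g y\<bar>) \<partial>M1) \<partial>M2)"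
    by (subst nn_integral_rectangle_column) auto
  also have "\<dots> = (\<integral>\<^sup>+y. w y * ennreal \<bar>g y\<bar> \<partial>M2)"
  proof (rule nn_integral_cong)
    fix y assume y: "y \<in> space M2"
    have "(\<integral>\<^sup>+x\<in>E. ennreal (\<bar>f (x, y)\<bar> * \<bar>g y\<bar>) \<partial>M1) = (\<integral>\<^sup>+x. (ennreal \<bar>f (x, y)\<bar> * indicator E x) * ennreal \<bar>g y\<bar> \<partial>M1)"
      by (intro nn_integral_cong) (simp add: ennreal_mult mult_ac)
    also have "\<dots> = w y * ennreal \<bar>g y\<bar>"
      unfolding w_def using y by (intro nn_integral_multc) measurable
    finally show "(\<integral>\<^sup>+x\<in>E. ennreal (\<bar>f (x, y)\<bar> * \<bar>g y\<bar>) \<partial>M1) * indicator (space M2) y = w y * ennreal \<bar>g y\<bar>"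
      using y by simp
  qed
  also have "\<dots> = (\<integral>\<^sup>+c\<in>{0<..}. (\<integral>\<^sup>+y. w y * indicator {y \<in> space M2. ennreal c < ennreal \<bar>g y\<bar>} y \<partial>M2) \<partial>lborel)"
    by (rule M2.layer_cake_weighted) measurable
  also have "\<dots> \<le> (\<integral>\<^sup>+c. ennreal B * (epowr (emeasure M2 {y \<in> space M2. c < \<bar>g y\<bar>}) (1 / r) * indicator {0<..} c) \<partial>lborel)"
  proof (rule nn_integral_mono)
    fix c :: real
    show "(\<integral>\<^sup>+y. w y * indicator {y \<in> space M2. ennreal c < ennreal \<bar>g y\<bar>} y \<partial>M2) * indicator {0<..} c
      \<le> ennreal B * (epowr (emeasure M2 {y \<in> space M2. c < \<bar>g y\<bar>}) (1 / r) * indicator {0<..} c)"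
    proof (cases "0 < c")
      case True
      let ?F = "{y \<in> space M2. c < \<bar>g y\<bar>}"
      have F: "?F \<in> sets M2" by measurable
      have fin: "emeasure M2 ?F < top" using Lorentz1_level_set_finite[OF g' g_fin True] .
      have "{y \<in> space M2. ennreal c < ennreal \<bar>g y\<bar>} = ?F"
        using True by (auto simp: ennreal_less_iff)
      then have "(\<integral>\<^sup>+y. w y * indicator {y \<in> space M2. ennreal c < ennreal \<bar>g y\<bar>} y \<partial>M2)
          = (\<integral>\<^sup>+z\<in>E \<times> ?F. ennreal \<bar>f z\<bar> \<partial>(M1 \<Otimes>\<^sub>M M2))"
        unfolding w_def using F by (subst nn_integral_rectangle_column) auto
      also have "\<dots> \<le> ennreal (B * measure M2 ?F powr (1 / r))" using bound[OF F fin] .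
      also have "\<dots> = ennreal B * epowr (emeasure M2 ?F) (1 / r)"
        using fin B by (simp add: emeasure_eq_ennreal_measure epowr_ennreal ennreal_mult)
      finally show ?thesis using True by simp
    qed simp
  qed
  also have "\<dots> = ennreal B * Lorentz1_norm r M2 g"
    unfolding Lorentz1_norm_def by (intro nn_integral_cmult) measurable
  finally show ?thesis .
qed

text \<open>The function \<open>h x = \<integral> \<bar>f (x, y)\<bar> \<bar>g y\<bar>\<close> has integral at most \<open>S \<parallel>g\<parallel> \<mu>\<^sub>1(E) powr (1 - 1/s)\<close> over each \<open>E\<close>.
  This gives its weak \<open>L\<^sub>s\<close> bound, and also its finiteness almost everywhere, that is, the absolute
  convergence of the integral defining the operator.\<close>
lemma rect_sup_finite_imp_kernel_op_bounded:
  assumes f [measurable]: "f \<in> borel_measurable (M1 \<Otimes>\<^sub>M M2)"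
    and s: "1 < s" and fin: "rect_sup 1 (1 - 1 / s) (1 / r) M1 M2 f < top"
  shows "kernel_op_bounded r s M1 M2 (\<lambda>z. \<bar>f z\<bar>)"
proof -
  define S where "S = enn2real (rect_sup 1 (1 - 1 / s) (1 / r) M1 M2 f)"
  have S: "0 \<le> S" "rect_sup 1 (1 - 1 / s) (1 / r) M1 M2 f \<le> ennreal S"
    using fin by (auto simp: S_def)
  have rect: "(\<integral>\<^sup>+z\<in>E \<times> F. ennreal \<bar>f z\<bar> \<partial>(M1 \<Otimes>\<^sub>M M2)) \<le> ennreal (S * measure M1 E powr (1 - 1 / s) * measure M2 F powr (1 / r))"
    if "E \<in> sets M1" "emeasure M1 E < top" "F \<in> sets M2" "emeasure M2 F < top" for E F
    using rect_sup_leD[OF zero_less_one S that] S by (simp add: mult.assoc)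
  have recip_s: "recip (ennreal s) = 1 / s" using s by (simp add: recip_ennreal)
  have 1: "(AE x in M1. integrable M2 (\<lambda>y. \<bar>f (x, y)\<bar> * g y)) \<and>
        kernel_op M2 (\<lambda>z. \<bar>f z\<bar>) g \<in> borel_measurable M1 \<and>
        (\<lambda>x. ennreal \<bar>kernel_op M2 (\<lambda>z. \<bar>f z\<bar>) g x\<bar>) \<in> weak_Lp (ennreal s) M1 \<and>
        weak_Lp_norm (ennreal s) M1 (\<lambda>x. ennreal \<bar>kernel_op M2 (\<lambda>z. \<bar>f z\<bar>) g x\<bar>) \<le> ennreal S * Lorentz1_norm r M2 g"
    if g: "g \<in> Lorentz1 r M2" for g
  proof -
    have g' [measurable]: "g \<in> borel_measurable M2" and g_fin: "Lorentz1_norm r M2 g < top"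
      using g by (auto simp: Lorentz1_def)
    define G where "G = enn2real (Lorentz1_norm r M2 g)"
    have G: "0 \<le> G" "Lorentz1_norm r M2 g = ennreal G" using g_fin by (auto simp: G_def)
    define h where "h x = (\<integral>\<^sup>+y. ennreal (\<bar>f (x, y)\<bar> * \<bar>g y\<bar>) \<partial>M2)" for x
    have h [measurable]: "h \<in> borel_measurable M1" unfolding h_def by measurable
    have hE: "(\<integral>\<^sup>+x\<in>E. h x \<partial>M1) \<le> ennreal (S * G * measure M1 E powr (1 - 1 / s))"
      if E: "E \<in> sets M1" "emeasure M1 E < top" for E
    proof -
      have "(\<integral>\<^sup>+x\<in>E. h x \<partial>M1) \<le> ennreal (S * measure M1 E powr (1 - 1 / s)) * Lorentz1_norm r M2 g"
        unfolding h_def using S E rect by (intro rectangle_bound_imp_Lorentz_bound[OF f g]) auto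
      also have "\<dots> = ennreal (S * measure M1 E powr (1 - 1 / s) * G)"
        using G S by (simp add: ennreal_mult)
      also have "S * measure M1 E powr (1 - 1 / s) * G = S * G * measure M1 E powr (1 - 1 / s)"
        by simp
      finally show ?thesis .
    qed
    have "AE x in M1. h x \<noteq> \<infinity>"
    proof -
      obtain A :: "nat \<Rightarrow> 'a set" where
        A: "range A \<subseteq> sets M1" "(\<Union>i. A i) = space M1" "\<And>i. emeasure M1 (A i) \<noteq> \<infinity>"
        by (rule M1.sigma_finite, rule that)
      have "AE x in M1. h x * indicator (A i) x \<noteq> \<infinity>" for i
      proof (rule nn_integral_PInf_AE)
        have [measurable]: "A i \<in> sets M1" using A by auto
        show "(\<lambda>x. h x * indicator (A i) x) \<in> borel_measurable M1" by measurable
        have "emeasure M1 (A i) < top" using A(3)[of i] by (simp add: less_top)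
        then have "(\<integral>\<^sup>+x. h x * indicator (A i) x \<partial>M1) < top"
          using order_le_less_trans[OF hE[of "A i"]] by simp
        then show "(\<integral>\<^sup>+x. h x * indicator (A i) x \<partial>M1) \<noteq> \<infinity>" by simp
      qed
      then have "AE x in M1. \<forall>i. h x * indicator (A i) x \<noteq> \<infinity>" by (simp add: AE_all_countable)
      then show ?thesis using AE_space
      proof eventually_elim
        fix x assume *: "\<forall>i. h x * indicator (A i) x \<noteq> \<infinity>" "x \<in> space M1"
        then obtain i where "x \<in> A i" using A(2) by blast
        then show "h x \<noteq> \<infinity>" using *(1)[rule_format, of i] by simp
      qed
    qed
    then have integrable: "AE x in M1. integrable M2 (\<lambda>y. \<bar>f (x, y)\<bar> * g y)"
      using AE_space
    proof eventually_elim
      fix x assume "h x \<noteq> \<infinity>" and x [measurable]: "x \<in> space M1"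
      then show "integrable M2 (\<lambda>y. \<bar>f (x, y)\<bar> * g y)"
        by (intro integrableI_bounded) (auto simp: h_def abs_mult less_top)
    qed
    have meas [measurable]: "kernel_op M2 (\<lambda>z. \<bar>f z\<bar>) g \<in> borel_measurable M1"
      unfolding kernel_op_def by measurable
    have pt: "ennreal \<bar>kernel_op M2 (\<lambda>z. \<bar>f z\<bar>) g x\<bar> \<le> h x" for x
    proof (cases "integrable M2 (\<lambda>y. \<bar>f (x, y)\<bar> * g y)")
      case True
      then show ?thesis
        using integral_norm_bound_ennreal[OF True] by (simp add: kernel_op_def h_def abs_mult)
    next
      case False
      then show ?thesis by (simp add: kernel_op_def not_integrable_integral_eq)
    qed
    have "weak_Lp_norm (ennreal s) M1 (\<lambda>x. epowr (ennreal \<bar>kernel_op M2 (\<lambda>z. \<bar>f z\<bar>) g x\<bar>) (1 / 1)) \<le> ennreal ((S * G) powr (1 / 1))"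
    proof (rule M1.integral_bound_imp_weak_Lp_norm)
      fix E assume E: "E \<in> sets M1" "emeasure M1 E < top"
      have "(\<integral>\<^sup>+x\<in>E. ennreal \<bar>kernel_op M2 (\<lambda>z. \<bar>f z\<bar>) g x\<bar> \<partial>M1) \<le> (\<integral>\<^sup>+x\<in>E. h x \<partial>M1)"
        using pt by (intro nn_integral_mono mult_right_mono) auto
      also note hE[OF E]
      finally show "(\<integral>\<^sup>+x\<in>E. ennreal \<bar>kernel_op M2 (\<lambda>z. \<bar>f z\<bar>) g x\<bar> \<partial>M1)
          \<le> ennreal (S * G * measure M1 E powr (1 - 1 * recip (ennreal s)))"
        by (simp add: recip_s)
    qed (use s S G in \<open>auto simp flip: ennreal_1 simp: ennreal_less_iff\<close>)
    then have weak: "weak_Lp_norm (ennreal s) M1 (\<lambda>x. ennreal \<bar>kernel_op M2 (\<lambda>z. \<bar>f z\<bar>) g x\<bar>) \<le> ennreal (S * G)"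
      using S G by simp
    moreover have "weak_Lp_norm (ennreal s) M1 (\<lambda>x. ennreal \<bar>kernel_op M2 (\<lambda>z. \<bar>f z\<bar>) g x\<bar>) < top"
      using weak by (rule order_le_less_trans) simp
    ultimately show ?thesis
      using integrable meas G S by (auto simp: weak_Lp_def ennreal_mult)
  qed
  show ?thesis
    unfolding kernel_op_bounded_def using S(1) 1 by blast
qed

text \<open>Test the operator on \<open>g = indicator F\<close>; the weak \<open>L\<^sub>s\<close> bound on its image is a bound for the integrals over
  the sets \<open>E\<close>.\<close>
lemma kernel_op_bounded_imp_rect_sup_finite:
  assumes f [measurable]: "f \<in> borel_measurable (M1 \<Otimes>\<^sub>M M2)"
    and s: "1 < s" and bdd: "kernel_op_bounded r s M1 M2 (\<lambda>z. \<bar>f z\<bar>)"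
  shows "rect_sup 1 (1 - 1 / s) (1 / r) M1 M2 f < top"
proof -
  obtain C where C: "0 \<le> C" and op: "\<And>g. g \<in> Lorentz1 r M2 \<Longrightarrow>
        (AE x in M1. integrable M2 (\<lambda>y. \<bar>f (x, y)\<bar> * g y)) \<and>
        kernel_op M2 (\<lambda>z. \<bar>f z\<bar>) g \<in> borel_measurable M1 \<and>
        weak_Lp_norm (ennreal s) M1 (\<lambda>x. ennreal \<bar>kernel_op M2 (\<lambda>z. \<bar>f z\<bar>) g x\<bar>)
          \<le> ennreal C * Lorentz1_norm r M2 g"
    using bdd unfolding kernel_op_bounded_def by blast
  have recip_s: "recip (ennreal s) = 1 / s" using s by (simp add: recip_ennreal)
  define A where "A = 1 / (1 - 1 / s)"
  have A: "0 \<le> A" using s by (simp add: A_def)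
  have "rect_sup 1 (1 - 1 / s) (1 / r) M1 M2 f \<le> ennreal (A * (C + 1))"
  proof (rule rect_sup_leI)
    show "0 \<le> A * (C + 1)" using A C by simp
    fix E F assume E [measurable]: "E \<in> sets M1" and F [measurable]: "F \<in> sets M2"
      and pos: "0 < measure M1 E" "0 < measure M2 F"
      and fin: "emeasure M1 E < top" "emeasure M2 F < top"
    let ?g = "indicator F :: 'b \<Rightarrow> real"
    let ?T = "kernel_op M2 (\<lambda>z. \<bar>f z\<bar>) ?g"
    have norm: "Lorentz1_norm r M2 ?g = ennreal (measure M2 F powr (1 / r))"
      using Lorentz1_norm_indicator[OF F fin(2)] .
    then have "?g \<in> Lorentz1 r M2" by (simp add: Lorentz1_def)
    note op = op[OF this]
    then have T_meas [measurable]: "?T \<in> borel_measurable M1" by blast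
    \<comment> \<open>\<open>C + 1\<close> instead of \<open>C\<close> keeps \<open>N\<close> positive when \<open>C = 0\<close>.\<close>
    define N where "N = (C + 1) * measure M2 F powr (1 / r)"
    have N: "0 < N" using C pos by (simp add: N_def)
    have "weak_Lp_norm (ennreal s) M1 (\<lambda>x. ennreal \<bar>?T x\<bar>) \<le> ennreal C * ennreal (measure M2 F powr (1 / r))"
      using op norm by simp
    also have "\<dots> \<le> ennreal N"
      using C by (simp add: N_def distrib_right ennreal_leI flip: ennreal_mult)
    finally have weak: "weak_Lp_norm (ennreal s) M1 (\<lambda>x. epowr (ennreal \<bar>?T x\<bar>) (1 / 1)) \<le> ennreal N"
      by simp
    have "AE x in M1. (\<integral>\<^sup>+y\<in>F. ennreal \<bar>f (x, y)\<bar> \<partial>M2) = ennreal \<bar>?T x\<bar>"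
      using op[THEN conjunct1]
    proof eventually_elim
      fix x assume int: "integrable M2 (\<lambda>y. \<bar>f (x, y)\<bar> * ?g y)"
      have "(\<integral>\<^sup>+y\<in>F. ennreal \<bar>f (x, y)\<bar> \<partial>M2) = (\<integral>\<^sup>+y. ennreal (\<bar>f (x, y)\<bar> * ?g y) \<partial>M2)"
        by (intro nn_integral_cong) (simp add: indicator_def)
      also have "\<dots> = ennreal (?T x)"
        unfolding kernel_op_def by (rule nn_integral_eq_integral[OF int]) simp
      also have "?T x = \<bar>?T x\<bar>"
        unfolding kernel_op_def by (simp add: Bochner_Integration.integral_nonneg)
      finally show "(\<integral>\<^sup>+y\<in>F. ennreal \<bar>f (x, y)\<bar> \<partial>M2) = ennreal \<bar>?T x\<bar>" .
    qed
    then have "(\<integral>\<^sup>+x\<in>E. (\<integral>\<^sup>+y\<in>F. ennreal \<bar>f (x, y)\<bar> \<partial>M2) \<partial>M1) = (\<integral>\<^sup>+x\<in>E. ennreal \<bar>?T x\<bar> \<partial>M1)"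
      by (intro nn_integral_cong_AE) (auto elim: eventually_mono)
    also have "\<dots> \<le> ennreal (1 / (1 - 1 * recip (ennreal s)) * N powr 1 * measure M1 E powr (1 - 1 * recip (ennreal s)))"
      using s N weak fin by (intro M1.weak_Lp_norm_imp_integral_bound) (auto simp flip: ennreal_1 simp: ennreal_less_iff)
    also have "1 / (1 - 1 * recip (ennreal s)) * N powr 1 * measure M1 E powr (1 - 1 * recip (ennreal s))
        = A * (C + 1) * (measure M1 E powr (1 - 1 / s) * measure M2 F powr (1 / r))"
      using N by (simp add: A_def recip_s N_def mult_ac)
    finally show "(\<integral>\<^sup>+z\<in>E \<times> F. ennreal (\<bar>f z\<bar> powr 1) \<partial>(M1 \<Otimes>\<^sub>M M2))
      \<le> ennreal ((A * (C + 1) * (measure M1 E powr (1 - 1 / s) * measure M2 F powr (1 / r))) powr 1)"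
      using A C by (simp add: nn_integral_rectangle_row)
  qed simp
  then show ?thesis by (rule order_le_less_trans) simp
qed

end

section \<open>The characterisation\<close>

theorem corollary6:
  fixes M1 :: "'a measure" and M2 :: "'b measure"
    and q \<theta> \<alpha>1 \<alpha>2 :: real and p1 p2 :: ennreal
  assumes "sigma_finite_measure M1" and "sigma_finite_measure M2"
    and "0 < q" and "ennreal q < p1" and "ennreal q < p2"
    and "0 < \<theta>" and "\<theta> < 1"
    and "\<alpha>1 = 1 / q - recip p1" and "\<alpha>2 = 1 / q - recip p2"
  shows "(\<forall>f \<in> borel_measurable (M1 \<Otimes>\<^sub>M M2).
            f \<in> mixed_interp_space q p1 p2 \<theta> M1 M2 \<longleftrightarrow>
            rect_sup q ((1 - \<theta>) * \<alpha>1) (\<theta> * \<alpha>2) M1 M2 f < top)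
      \<and> (\<exists>c C :: real. 0 < c \<and> 0 < C \<and>
          (\<forall>f \<in> borel_measurable (M1 \<Otimes>\<^sub>M M2).
            ennreal c * rect_sup q ((1 - \<theta>) * \<alpha>1) (\<theta> * \<alpha>2) M1 M2 f
              \<le> mixed_interp_norm q p1 p2 \<theta> M1 M2 f \<and>
            mixed_interp_norm q p1 p2 \<theta> M1 M2 f
              \<le> ennreal C * rect_sup q ((1 - \<theta>) * \<alpha>1) (\<theta> * \<alpha>2) M1 M2 f))
      \<and> (q = 1 \<longrightarrow>
          \<theta> * \<alpha>2 = \<theta> * recip (conj_exponent p2) \<and>
          (\<forall>r s :: real.
            1 / r = \<theta> * \<alpha>2 \<and> 1 - 1 / s = (1 - \<theta>) * recip (conj_exponent p1) \<longrightarrow>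
            (\<forall>f \<in> borel_measurable (M1 \<Otimes>\<^sub>M M2).
              rect_sup q ((1 - \<theta>) * \<alpha>1) (\<theta> * \<alpha>2) M1 M2 f < top \<longleftrightarrow>
              kernel_op_bounded r s M1 M2 (\<lambda>z. \<bar>f z\<bar>))))"
proof -
  interpret pair_sigma_finite M1 M2
    using assms(1,2) by (rule pair_sigma_finite.intro)
  note q = assms(3,4,5) and \<theta> = assms(6,7)
  let ?R = "\<lambda>f. rect_sup q ((1 - \<theta>) * \<alpha>1) (\<theta> * \<alpha>2) M1 M2 f"
  let ?N = "\<lambda>f. mixed_interp_norm q p1 p2 \<theta> M1 M2 f"
  define D where "D = 2 * (1 / (1 - q * recip p1) + 1 / (1 - q * recip p2)) powr (1 / q)"
  have D: "0 < D" unfolding D_def using q by (rule lower_constant_pos)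
  have lower: "?R f \<le> ennreal D * ?N f" if "f \<in> borel_measurable (M1 \<Otimes>\<^sub>M M2)" for f
    unfolding D_def assms(8,9) using rect_sup_le_interp_norm[OF that q \<theta>] .
  have upper: "?N f \<le> ennreal (2 * 4 powr (1 / q)) * ?R f" if "f \<in> borel_measurable (M1 \<Otimes>\<^sub>M M2)" for f
    unfolding assms(8,9) using interp_norm_le_rect_sup[OF that q \<theta>] .
  have lower': "ennreal (1 / D) * ?R f \<le> ?N f" if "f \<in> borel_measurable (M1 \<Otimes>\<^sub>M M2)" for f
  proof -
    have "ennreal (1 / D) * ?R f \<le> ennreal (1 / D) * (ennreal D * ?N f)"
      using lower[OF that] by (rule mult_left_mono) simp
    also have "\<dots> = ?N f" using D by (simp flip: mult.assoc ennreal_mult)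
    finally show ?thesis .
  qed
  have finite_iff: "?N f < top \<longleftrightarrow> ?R f < top" if "f \<in> borel_measurable (M1 \<Otimes>\<^sub>M M2)" for f
    using lower[OF that] upper[OF that]
    by (metis ennreal_less_top ennreal_mult_less_top order_le_less_trans)
  have space_iff: "f \<in> mixed_interp_space q p1 p2 \<theta> M1 M2 \<longleftrightarrow> ?N f < top"
    if f: "f \<in> borel_measurable (M1 \<Otimes>\<^sub>M M2)" for f
  proof
    assume fin: "?N f < top"
    \<comment> \<open>An infimum over no decompositions would be \<open>\<infinity>\<close>.\<close>
    have "decompositions (M1 \<Otimes>\<^sub>M M2) (mixed_space1 p1 q M1 M2) (mixed_space2 p2 q M1 M2) f \<noteq> {}"
    proof
      assume "decompositions (M1 \<Otimes>\<^sub>M M2) (mixed_space1 p1 q M1 M2) (mixed_space2 p2 q M1 M2) f = {}"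
      then have "top \<le> ?N f"
        unfolding mixed_interp_norm_def interp_norm_def K_functional_def
        by (intro SUP_upper2[of 1]) auto
      then show False using fin by simp
    qed
    then show "f \<in> mixed_interp_space q p1 p2 \<theta> M1 M2"
      using f fin by (simp add: mixed_interp_space_def interp_space_def mixed_interp_norm_def)
  qed (simp add: mixed_interp_space_def interp_space_def mixed_interp_norm_def)
  have kernel: "\<theta> * \<alpha>2 = \<theta> * recip (conj_exponent p2) \<and>
          (\<forall>r s :: real.
            1 / r = \<theta> * \<alpha>2 \<and> 1 - 1 / s = (1 - \<theta>) * recip (conj_exponent p1) \<longrightarrow>
            (\<forall>f \<in> borel_measurable (M1 \<Otimes>\<^sub>M M2). ?R f < top \<longleftrightarrow> kernel_op_bounded r s M1 M2 (\<lambda>z. \<bar>f z\<bar>)))"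
    if q1: "q = 1"
  proof (intro conjI allI impI ballI)
    have p: "1 < p1" "1 < p2" using q q1 by simp_all
    have \<alpha>: "\<alpha>1 = recip (conj_exponent p1)" "\<alpha>2 = recip (conj_exponent p2)"
      using recip_conj_exponent p assms(8,9) q1 by simp_all
    then show "\<theta> * \<alpha>2 = \<theta> * recip (conj_exponent p2)" by simp
    fix r s :: real and f :: "'a \<times> 'b \<Rightarrow> real"
    assume rs: "1 / r = \<theta> * \<alpha>2 \<and> 1 - 1 / s = (1 - \<theta>) * recip (conj_exponent p1)"
      and f: "f \<in> borel_measurable (M1 \<Otimes>\<^sub>M M2)"
    have "0 < \<alpha>1" "\<alpha>1 \<le> 1" using recip_bounds[OF q(1,2)] q1 assms(8) by simp_all
    then have "(1 - \<theta>) * \<alpha>1 \<le> 1 - \<theta>" "0 < (1 - \<theta>) * \<alpha>1"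
      using mult_left_mono[of \<alpha>1 1 "1 - \<theta>"] \<theta> by auto
    then have "0 < (1 - \<theta>) * \<alpha>1" "(1 - \<theta>) * \<alpha>1 < 1" using \<theta> by linarith+
    moreover have "1 - 1 / s = (1 - \<theta>) * \<alpha>1" using rs \<alpha> by simp
    ultimately have "0 < 1 / s" "1 / s < 1" by linarith+
    then have s: "1 < s" by (simp add: divide_less_eq split: if_splits)
    have R: "?R f = rect_sup 1 (1 - 1 / s) (1 / r) M1 M2 f" using rs \<alpha> q1 by simp
    show "?R f < top \<longleftrightarrow> kernel_op_bounded r s M1 M2 (\<lambda>z. \<bar>f z\<bar>)"
      unfolding R using rect_sup_finite_imp_kernel_op_bounded[OF f s] kernel_op_bounded_imp_rect_sup_finite[OF f s]
      by blast
  qed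
  show ?thesis
    using lower' upper finite_iff space_iff kernel D
    by (intro conjI ballI exI[of _ "1 / D"] exI[of _ "2 * 4 powr (1 / q)"]) auto
qed

end
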